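(* Let $S$ be a rectangular domain. (a) Let $\ell_1\prec\ell_2\prec\cdots\prec\ell_n$ be elements of $C(S)$ and let $w_1,\dots,w_n>0$. Then there is a unique flow field $\bar\eta$ on $\mathbb{E}(\bar S)$ such that, for every $\ell\in C(S)$, $w_\eta(\ell)=w_j$ if $\ell=\ell_j$ for some $j$, and $w_\eta(\ell)=0$ otherwise. (b) Conversely, let $\bar\eta$ be any flow field on $\mathbb{E}(\bar S)$. Then the set $\{\ell\in C(S):w_\eta(\ell)>0\}$ is totally ordered by $\succeq$. Write it as $\ell_1\prec\cdots\prec\ell_n$ and put $w_j=w_\eta(\ell_j)$; these are the unique data for which the characterization in (a) holds. Moreover the following decompositions hold: $$\eta(e)=\sum_j w_j\,\mathbf{1}_{\{e\text{ is an edge of }\ell_j\}}\quad (e\in\mathbb{E}(\bar S)),\qquad \xi_y=\sum_j w_j\,\mathbf{1}_{L(\ell_j)}(y)\quad(y\in S),$$ $$\zeta^\pm_y=\sum_j w_j\,[\zeta^\pm(\ell_j)]_y .$$ Furthermore, for every broken trace $\ell\subseteq\bar S$, $$w_\eta(\ell)=\sum_{\ell'\in C(S)} w_\eta(\ell')\,\mathbf{1}_{\{\ell\subseteq\ell'\}}.$$ By part (b), the flow field constructed in part (a) also satisfies all of these decompositions and the weight formula.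
   Context: Lattice and edges. $\tilde{\mathbb{Z}}^2=\{(t,x)\in\mathbb{Z}^2:t+x\text{ even}\}$; edges $\langle y,y'\rangle$ join points at distance $\sqrt2$. For $y=(t,x)$: - $e^\nearrow_y=\langle(t,x),(t+1,x+1)\rangle$, - $e^\searrow_y=\langle(t,x),(t+1,x-1)\rangle$, - $e^\swarrow_y=\langle(t-1,x-1),(t,x)\rangle$, - $e^\nwarrow_y=\langle(t-1,x+1),(t,x)\rangle$. Domains. A rectangular domain is a nonempty set $S=\{(t,x)\in\tilde{\mathbb{Z}}^2: a\le t+x\le b,\ c\le t-x\le d\}$ with even integers $a\le b$, $c\le d$. $\bar S$ is $S$ together with all points joined by an edge to a point of $S$; $\partial\bar S=\bar S\setminus S$; $\mathbb{E}(\bar S)$ is the set of edges with at least one endpoint in $S$. Flow field and its associated fields. A flow field is $\eta(e)\ge0$, $e\in\mathbb{E}(\bar S)$, with $\eta(e^\nwarrow_y)+\eta(e^\nearrow_y)=\eta(e^\swarrow_y)+\eta(e^\searrow_y)$ for all $y\in S$. - Its birth field is $\xi_y=\eta(e^\nearrow_y)\wedge\eta(e^\searrow_y)$, $y\in S$. - Its boundary inflows are $\zeta^+_y=\eta(e^\swarrow_y)$ for $y=(t,x)\in S$ with $(t-1,x-1)\in\partial\bar S$, and $\zeta^-_y=\eta(e^\nwarrow_y)$ for $y\in S$ with $(t-1,x+1)\in\partial\bar S$. Association. For $y\in S$, a lower edge $f_1\in\{e^\swarrow_y,e^\searrow_y\}$ with $p_1\in(0,\eta(f_1)]$, and an upper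 edge $f_2\in\{e^\nwarrow_y,e^\nearrow_y\}$ with $p_2\in(0,\eta(f_2)]$, write $(f_1,p_1)\sim_y(f_2,p_2)$ exactly when: - Case 1: $f_1=e^\swarrow_y$, $f_2=e^\nwarrow_y$, $p_1\le\eta(f_1)\wedge\eta(f_2)$, $p_2=p_1$; - Case 2: $f_1=e^\searrow_y$, $f_2=e^\nwarrow_y$, $p_2>\eta(e^\swarrow_y)$, $p_1=p_2-\eta(e^\swarrow_y)$; - Case 3: $f_1=e^\swarrow_y$, $f_2=e^\nearrow_y$, $p_1>\eta(e^\nwarrow_y)$, $p_2=p_1-\eta(e^\nwarrow_y)$; - Case 4: $f_1=e^\searrow_y$, $f_2=e^\nearrow_y$, $p_i>\eta(f_i)-\xi_y$ ($i=1,2$), $\eta(f_1)-p_1=\eta(f_2)-p_2$. Broken traces. A broken trace is $\ell=(y_0,e_1,y_1,\dots,e_n,y_n)$, $n\ge1$, with $y_i=(t_i,x_i)\in\tilde{\mathbb{Z}}^2$, $e_i=\langle y_{i-1},y_i\rangle$, $x_i=x_{i-1}+1$, $t_i-t_{i-1}\in\{-1,1\}$. - $D(\ell)=\{x_0,\dots,x_n\}$, and $t_\ell(x)$ is the $t$-coordinate of the vertex of $\ell$ at second coordinate $x$. - $\ell\subseteq\bar S$ means $y_0,y_n\in\bar S$, $y_1,\dots,y_{n-1}\in S$, all $e_i\in\mathbb{E}(\bar S)$. - $C(S)$ is the set of $\ell\subseteq\bar S$ with $y_0,y_n\in\partial\bar S$. - $L(\ell)$ (left corners) is the set of vertices $(t,x)$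 of $\ell$ such that $(t+1,x-1)$ and $(t+1,x+1)$ are both vertices of $\ell$. - $[\zeta^+(\ell)]_{(t,x)}=1$ if $(t,x)\in S$ is a vertex of $\ell$ and $(t-1,x-1)$ is a vertex of $\ell$ lying in $\partial\bar S$; otherwise it is $0$. - $[\zeta^-(\ell)]_{(t,x)}=1$ if $(t,x)\in S$ is a vertex of $\ell$ and $(t-1,x+1)$ is a vertex of $\ell$ lying in $\partial\bar S$; otherwise it is $0$. Weight. $w_\eta(\ell)$, for $\ell\subseteq\bar S$, is the Lebesgue measure of the set of $p_1\in(0,\eta(e_1)]$ for which there exist $p_i\in(0,\eta(e_i)]$ ($i=2,\dots,n$) with $(e_{i-1},p_{i-1})\sim_{y_{i-1}}(e_i,p_i)$ for all $i=2,\dots,n$. Relations between traces. - $\ell\subseteq\ell'$ means $D(\ell)\subseteq D(\ell')$ and $t_\ell=t_{\ell'}$ on $D(\ell)$. - $\ell\succeq\ell'$ means $t_\ell(x)\ge t_{\ell'}(x)$ for all $x\in D(\ell)\cap D(\ell')$, and $t_\ell(x)\ge t_{\ell'}(x')$ for some $x\in D(\ell)$, $x'\in D(\ell')$. - $\ell\succ\ell'$ means $\ell\succeq\ell'$ and $\ell\ne\ell'$; $\ell\prec\ell'$ means $\ell'\succ\ell$. *)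

theory Defs
  imports "HOL-Analysis.Analysis"
begin

type_synonym pt = "int \<times> int"        (* (t, x) *)
type_synonym edge = "pt \<times> pt"       (* (lower-time endpoint, upper-time endpoint) *)
type_synonym trace = "pt \<times> int list" (* start vertex y_0 and the time increments t_i - t_{i-1} *)

definition lat :: "pt set" where
  "lat = {(t, x). even (t + x)}"

(* unordered edges are stored with the endpoint of smaller t first *)
definition mk_edge :: "pt \<Rightarrow> pt \<Rightarrow> edge" where
  "mk_edge y y' = (if fst y \<le> fst y' then (y, y') else (y', y))"

definition e_ne :: "pt \<Rightarrow> edge" where "e_ne y = (case y of (t, x) \<Rightarrow> ((t, x), (t + 1, x + 1)))"
definition e_se :: "pt \<Rightarrow> edge" where "e_se y = (case y of (t, x) \<Rightarrow> ((t, x), (t + 1, x - 1)))"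
definition e_sw :: "pt \<Rightarrow> edge" where "e_sw y = (case y of (t, x) \<Rightarrow> ((t - 1, x - 1), (t, x)))"
definition e_nw :: "pt \<Rightarrow> edge" where "e_nw y = (case y of (t, x) \<Rightarrow> ((t - 1, x + 1), (t, x)))"

definition rect_domain :: "int \<Rightarrow> int \<Rightarrow> int \<Rightarrow> int \<Rightarrow> pt set" where
  "rect_domain a b c d =
     {(t, x). even (t + x) \<and> a \<le> t + x \<and> t + x \<le> b \<and> c \<le> t - x \<and> t - x \<le> d}"

definition nbrs :: "pt \<Rightarrow> pt set" where
  "nbrs y = (case y of (t, x) \<Rightarrow> {(t + 1, x + 1), (t + 1, x - 1), (t - 1, x - 1), (t - 1, x + 1)})"

definition closure_dom :: "pt set \<Rightarrow> pt set" where
  "closure_dom S = S \<union> {y'. \<exists>y\<in>S. y' \<in> nbrs y}"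

definition bdry :: "pt set \<Rightarrow> pt set" where
  "bdry S = closure_dom S - S"

definition edges_dom :: "pt set \<Rightarrow> edge set" where
  "edges_dom S = {e. \<exists>y\<in>S. e = e_ne y \<or> e = e_se y \<or> e = e_sw y \<or> e = e_nw y}"

definition flow_field :: "pt set \<Rightarrow> (edge \<Rightarrow> real) \<Rightarrow> bool" where
  "flow_field S \<eta> \<longleftrightarrow>
     (\<forall>e\<in>edges_dom S. 0 \<le> \<eta> e) \<and>
     (\<forall>y\<in>S. \<eta> (e_nw y) + \<eta> (e_ne y) = \<eta> (e_sw y) + \<eta> (e_se y))"

definition birth :: "(edge \<Rightarrow> real) \<Rightarrow> pt \<Rightarrow> real" where
  "birth \<eta> y = min (\<eta> (e_ne y)) (\<eta> (e_se y))"

definition zp_dom :: "pt set \<Rightarrow> pt set" where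
  "zp_dom S = {(t, x). (t, x) \<in> S \<and> (t - 1, x - 1) \<in> bdry S}"
definition zm_dom :: "pt set \<Rightarrow> pt set" where
  "zm_dom S = {(t, x). (t, x) \<in> S \<and> (t - 1, x + 1) \<in> bdry S}"
definition zeta_plus :: "(edge \<Rightarrow> real) \<Rightarrow> pt \<Rightarrow> real" where
  "zeta_plus \<eta> y = \<eta> (e_sw y)"
definition zeta_minus :: "(edge \<Rightarrow> real) \<Rightarrow> pt \<Rightarrow> real" where
  "zeta_minus \<eta> y = \<eta> (e_nw y)"

definition assoc :: "(edge \<Rightarrow> real) \<Rightarrow> pt \<Rightarrow> edge \<Rightarrow> real \<Rightarrow> edge \<Rightarrow> real \<Rightarrow> bool" where
  "assoc \<eta> y f1 p1 f2 p2 \<longleftrightarrow>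
     (f1 = e_sw y \<or> f1 = e_se y) \<and> 0 < p1 \<and> p1 \<le> \<eta> f1 \<and>
     (f2 = e_nw y \<or> f2 = e_ne y) \<and> 0 < p2 \<and> p2 \<le> \<eta> f2 \<and>
     ((f1 = e_sw y \<and> f2 = e_nw y \<and> p1 \<le> min (\<eta> f1) (\<eta> f2) \<and> p2 = p1) \<or>
      (f1 = e_se y \<and> f2 = e_nw y \<and> p2 > \<eta> (e_sw y) \<and> p1 = p2 - \<eta> (e_sw y)) \<or>
      (f1 = e_sw y \<and> f2 = e_ne y \<and> p1 > \<eta> (e_nw y) \<and> p2 = p1 - \<eta> (e_nw y)) \<or>
      (f1 = e_se y \<and> f2 = e_ne y \<and> p1 > \<eta> f1 - birth \<eta> y \<and> p2 > \<eta> f2 - birth \<eta> y \<and>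
       \<eta> f1 - p1 = \<eta> f2 - p2))"

definition is_trace :: "trace \<Rightarrow> bool" where
  "is_trace l \<longleftrightarrow> fst l \<in> lat \<and> snd l \<noteq> [] \<and> set (snd l) \<subseteq> {-1, 1}"

definition tlen :: "trace \<Rightarrow> nat" where
  "tlen l = length (snd l)"

definition vtx :: "trace \<Rightarrow> nat \<Rightarrow> pt" where
  "vtx l i = (fst (fst l) + sum_list (take i (snd l)), snd (fst l) + int i)"

(* edge e_i = <y_{i-1}, y_i>, for 1 <= i <= n *)
definition tedge :: "trace \<Rightarrow> nat \<Rightarrow> edge" where
  "tedge l i = mk_edge (vtx l (i - 1)) (vtx l i)"

definition vertices :: "trace \<Rightarrow> pt set" where
  "vertices l = vtx l ` {0..tlen l}"

definition tedges :: "trace \<Rightarrow> edge set" where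
  "tedges l = tedge l ` {1..tlen l}"

definition Dom :: "trace \<Rightarrow> int set" where
  "Dom l = {snd (fst l) .. snd (fst l) + int (tlen l)}"

definition tfun :: "trace \<Rightarrow> int \<Rightarrow> int" where
  "tfun l x = fst (vtx l (nat (x - snd (fst l))))"

definition in_closure :: "pt set \<Rightarrow> trace \<Rightarrow> bool" where
  "in_closure S l \<longleftrightarrow>
     vtx l 0 \<in> closure_dom S \<and> vtx l (tlen l) \<in> closure_dom S \<and>
     (\<forall>i. 1 \<le> i \<and> i < tlen l \<longrightarrow> vtx l i \<in> S) \<and>
     (\<forall>i. 1 \<le> i \<and> i \<le> tlen l \<longrightarrow> tedge l i \<in> edges_dom S)"

definition Ctr :: "pt set \<Rightarrow> trace set" where
  "Ctr S = {l. is_trace l \<and> in_closure S l \<and> vtx l 0 \<in> bdry S \<and> vtx l (tlen l) \<in> bdry S}"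

definition left_corners :: "trace \<Rightarrow> pt set" where
  "left_corners l = {(t, x). (t, x) \<in> vertices l \<and> (t + 1, x - 1) \<in> vertices l \<and> (t + 1, x + 1) \<in> vertices l}"

definition zp_tr :: "pt set \<Rightarrow> trace \<Rightarrow> pt \<Rightarrow> real" where
  "zp_tr S l y = (case y of (t, x) \<Rightarrow>
     if (t, x) \<in> S \<and> (t, x) \<in> vertices l \<and> (t - 1, x - 1) \<in> vertices l \<and> (t - 1, x - 1) \<in> bdry S
     then 1 else 0)"

definition zm_tr :: "pt set \<Rightarrow> trace \<Rightarrow> pt \<Rightarrow> real" where
  "zm_tr S l y = (case y of (t, x) \<Rightarrow>
     if (t, x) \<in> S \<and> (t, x) \<in> vertices l \<and> (t - 1, x + 1) \<in> vertices l \<and> (t - 1, x + 1) \<in> bdry S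
     then 1 else 0)"

definition weight :: "(edge \<Rightarrow> real) \<Rightarrow> trace \<Rightarrow> real" where
  "weight \<eta> l = measure lebesgue
     {p1. 0 < p1 \<and> p1 \<le> \<eta> (tedge l 1) \<and>
          (\<exists>p :: nat \<Rightarrow> real. p 1 = p1 \<and>
             (\<forall>i. 2 \<le> i \<and> i \<le> tlen l \<longrightarrow> 0 < p i \<and> p i \<le> \<eta> (tedge l i)) \<and>
             (\<forall>i. 2 \<le> i \<and> i \<le> tlen l \<longrightarrow>
                assoc \<eta> (vtx l (i - 1)) (tedge l (i - 1)) (p (i - 1)) (tedge l i) (p i)))}"

definition subtrace :: "trace \<Rightarrow> trace \<Rightarrow> bool" where
  "subtrace l l' \<longleftrightarrow> Dom l \<subseteq> Dom l' \<and> (\<forall>x\<in>Dom l. tfun l x = tfun l' x)"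

definition tsucceq :: "trace \<Rightarrow> trace \<Rightarrow> bool" where
  "tsucceq l l' \<longleftrightarrow>
     (\<forall>x\<in>Dom l \<inter> Dom l'. tfun l x \<ge> tfun l' x) \<and>
     (\<exists>x\<in>Dom l. \<exists>x'\<in>Dom l'. tfun l x \<ge> tfun l' x')"

definition tsucc :: "trace \<Rightarrow> trace \<Rightarrow> bool" where
  "tsucc l l' \<longleftrightarrow> tsucceq l l' \<and> l \<noteq> l'"

definition tprec :: "trace \<Rightarrow> trace \<Rightarrow> bool" where
  "tprec l l' \<longleftrightarrow> tsucc l' l"

definition prec_chain :: "trace list \<Rightarrow> bool" where
  "prec_chain ls \<longleftrightarrow> (\<forall>i j. i < j \<and> j < length ls \<longrightarrow> tprec (ls ! i) (ls ! j))"

definition characterizes :: "pt set \<Rightarrow> (edge \<Rightarrow> real) \<Rightarrow> trace list \<Rightarrow> real list \<Rightarrow> bool" where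
  "characterizes S \<eta> ls ws \<longleftrightarrow>
     (\<forall>j<length ls. weight \<eta> (ls ! j) = ws ! j) \<and>
     (\<forall>l\<in>Ctr S. l \<notin> set ls \<longrightarrow> weight \<eta> l = 0)"

end

theory Submission
  imports Defs
begin

text \<open>Points \<open>(t, x)\<close> with \<open>t + x\<close> odd are the faces of the lattice. Conservation makes a flow field
  the gradient of a potential \<open>h\<close> on faces: \<open>\<eta> e\<close> is the increase of \<open>h\<close> across \<open>e\<close> from its western to
  its eastern side, so \<open>h\<close> is increasing in \<open>t + x\<close> and \<open>t - x\<close>. A position \<open>p\<close> on \<open>e\<close> corresponds to the
  level \<open>h (west e) + p\<close>, and positions are associated iff their levels agree. Hence \<open>weight \<eta> l\<close> is the
  length of the set of levels \<open>s\<close> with \<open>h (west e) < s \<le> h (east e)\<close> for all edges \<open>e\<close> of \<open>l\<close>. For each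
  relevant \<open>s\<close> these edges form one trace of \<open>Ctr S\<close>, the interface between \<open>{h < s}\<close> and \<open>{h \<ge> s}\<close>;
  so the level sets of the traces in \<open>Ctr S\<close> partition the range of \<open>h\<close>, which gives all decompositions,
  and nestedness of the sets \<open>{h < s}\<close> gives the total order. Conversely, a chain \<open>l\<^sub>1 \<prec> \<dots> \<prec> l\<^sub>n\<close> with
  weights \<open>w\<^sub>j\<close> is realised by letting \<open>h f\<close> be the sum of those \<open>w\<^sub>j\<close> for which \<open>f\<close> lies east of \<open>l\<^sub>j\<close>.\<close>

subsection \<open>Traces and faces\<close>

definition is_edge :: "edge \<Rightarrow> bool" where
  "is_edge e \<longleftrightarrow> fst (snd e) = fst (fst e) + 1 \<and> \<bar>snd (snd e) - snd (fst e)\<bar> = 1"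

definition west :: "edge \<Rightarrow> pt" where "west e = (fst (fst e), snd (snd e))"
definition east :: "edge \<Rightarrow> pt" where "east e = (fst (snd e), snd (fst e))"

definition cone_le :: "pt \<Rightarrow> pt \<Rightarrow> bool" (infix "\<sqsubseteq>" 50) where
  "p \<sqsubseteq> q \<longleftrightarrow> fst p + snd p \<le> fst q + snd q \<and> fst p - snd p \<le> fst q - snd q"

abbreviation first_x :: "trace \<Rightarrow> int" where "first_x l \<equiv> snd (fst l)"
abbreviation last_x :: "trace \<Rightarrow> int" where "last_x l \<equiv> snd (fst l) + int (tlen l)"

lemma vtx_0: "vtx l 0 = fst l"
  by (simp add: vtx_def)

lemma vtx_Suc:
  "i < tlen l \<Longrightarrow> vtx l (Suc i) = (fst (vtx l i) + snd l ! i, snd (vtx l i) + 1)"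
  by (simp add: vtx_def tlen_def take_Suc_conv_app_nth)

lemma vtx_Cons: "vtx ((t, x), \<delta> # ds) (Suc i) = vtx ((t + \<delta>, x + 1), ds) i"
  by (simp add: vtx_def)

lemma trace_step:
  assumes "is_trace l" "i < tlen l"
  shows "snd l ! i = 1 \<or> snd l ! i = -1"
proof -
  have "snd l ! i \<in> set (snd l)" using assms(2) by (simp add: tlen_def)
  then show ?thesis using assms(1) by (auto simp: is_trace_def)
qed

lemma tlen_pos: "is_trace l \<Longrightarrow> 0 < tlen l"
  by (simp add: is_trace_def tlen_def)

lemma vtx_even:
  assumes "is_trace l" "i \<le> tlen l"
  shows "even (fst (vtx l i) + snd (vtx l i))"
  using assms(2)
proof (induction i)
  case 0
  then show ?case using assms(1) by (auto simp: is_trace_def lat_def vtx_0)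
next
  case (Suc i)
  then show ?case using trace_step[OF assms(1), of i] by (auto simp: vtx_Suc)
qed

lemma vtx_eq_tfun: "vtx l i = (tfun l (first_x l + int i), first_x l + int i)"
  by (simp add: tfun_def vtx_def)

lemma mem_vertices_iff: "p \<in> vertices l \<longleftrightarrow> snd p \<in> Dom l \<and> fst p = tfun l (snd p)"
proof
  assume "p \<in> vertices l"
  then obtain i where "i \<le> tlen l" "p = vtx l i" by (auto simp: vertices_def)
  then show "snd p \<in> Dom l \<and> fst p = tfun l (snd p)"
    by (simp add: Dom_def vtx_eq_tfun)
next
  assume *: "snd p \<in> Dom l \<and> fst p = tfun l (snd p)"
  define i where "i = nat (snd p - first_x l)"
  have i: "snd p = first_x l + int i" "i \<le> tlen l" using * by (auto simp: i_def Dom_def)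
  have "p = vtx l i" using * i(1) by (metis prod.collapse vtx_eq_tfun)
  then show "p \<in> vertices l" using i(2) by (auto simp: vertices_def)
qed

lemma vtx_in_vertices: "i \<le> tlen l \<Longrightarrow> vtx l i \<in> vertices l"
  by (auto simp: vertices_def)

lemma tfun_step:
  assumes "is_trace l" "first_x l \<le> x" "x < last_x l"
  shows "tfun l (x + 1) = tfun l x + 1 \<or> tfun l (x + 1) = tfun l x - 1"
proof -
  define i where "i = nat (x - first_x l)"
  have i: "x = first_x l + int i" "i < tlen l" using assms by (auto simp: i_def)
  show ?thesis
    using trace_step[OF assms(1) i(2)] vtx_Suc[OF i(2)] vtx_eq_tfun[of l i] vtx_eq_tfun[of l "Suc i"] i(1)
    by (auto simp: algebra_simps)
qed

lemma tfun_even: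
  assumes "is_trace l" "x \<in> Dom l"
  shows "even (tfun l x + x)"
proof -
  define i where "i = nat (x - first_x l)"
  have i: "x = first_x l + int i" "i \<le> tlen l" using assms by (auto simp: i_def Dom_def)
  show ?thesis using vtx_even[OF assms(1) i(2)] i(1) by (simp add: vtx_eq_tfun)
qed

lemma tfun_lipschitz_le:
  assumes "is_trace l" "first_x l \<le> x" "x \<le> y" "y \<le> last_x l"
  shows "\<bar>tfun l y - tfun l x\<bar> \<le> y - x"
  using assms(3,4)
proof (induction y rule: int_ge_induct)
  case base
  then show ?case by simp
next
  case (step y)
  then show ?case using tfun_step[OF assms(1), of y] assms(2) by auto
qed

lemma vertices_lipschitz:
  assumes "is_trace l" "p \<in> vertices l" "q \<in> vertices l"
  shows "\<bar>fst p - fst q\<bar> \<le> \<bar>snd p - snd q\<bar>"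
  using assms tfun_lipschitz_le[OF assms(1), of "snd p" "snd q"]
    tfun_lipschitz_le[OF assms(1), of "snd q" "snd p"]
  by (cases "snd p \<le> snd q") (auto simp: mem_vertices_iff Dom_def)

lemma vertices_even:
  assumes "is_trace l" "p \<in> vertices l"
  shows "even (fst p + snd p)"
  using assms tfun_even by (auto simp: mem_vertices_iff)

lemma mem_tedges_iff:
  assumes "is_trace l"
  shows "e \<in> tedges l \<longleftrightarrow> is_edge e \<and> fst e \<in> vertices l \<and> snd e \<in> vertices l"
proof
  assume "e \<in> tedges l"
  then obtain i where i: "1 \<le> i" "i \<le> tlen l" "e = tedge l i" by (auto simp: tedges_def)
  define k where "k = i - 1"
  have k: "i = Suc k" "k < tlen l" using i by (auto simp: k_def)
  have e: "e = mk_edge (vtx l k) (vtx l (Suc k))" using i k by (simp add: tedge_def)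
  have "vtx l k \<in> vertices l" "vtx l (Suc k) \<in> vertices l"
    using k(2) by (auto intro: vtx_in_vertices)
  moreover have "is_edge e"
    using trace_step[OF assms k(2)] unfolding e mk_edge_def is_edge_def
    by (auto simp: vtx_Suc[OF k(2)])
  ultimately show "is_edge e \<and> fst e \<in> vertices l \<and> snd e \<in> vertices l"
    unfolding e mk_edge_def by auto
next
  assume *: "is_edge e \<and> fst e \<in> vertices l \<and> snd e \<in> vertices l"
  obtain t x t' x' where e: "e = ((t, x), (t', x'))" by (metis prod.collapse)
  have tx: "t' = t + 1" "x' = x + 1 \<or> x' = x - 1" using * by (auto simp: e is_edge_def)
  have v: "(t, x) \<in> vertices l" "(t', x') \<in> vertices l" using * by (auto simp: e)
  define m where "m = min x x'"
  define k where "k = nat (m - first_x l)"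
  have dm: "x \<in> Dom l" "x' \<in> Dom l" "t = tfun l x" "t' = tfun l x'"
    using v by (auto simp: mem_vertices_iff)
  have k: "m = first_x l + int k" "Suc k \<le> tlen l"
    using dm(1,2) tx(2) by (auto simp: k_def m_def Dom_def)
  have "vtx l k = (tfun l m, m)" "vtx l (Suc k) = (tfun l (m + 1), m + 1)"
    using k(1) by (simp_all add: vtx_eq_tfun algebra_simps)
  then have "tedge l (Suc k) = e"
    using tx dm(3,4) by (auto simp: tedge_def mk_edge_def e m_def)
  then show "e \<in> tedges l" using k(2) by (force simp: tedges_def)
qed

lemma snd_vertices: "snd ` vertices l = Dom l"
proof
  show "Dom l \<subseteq> snd ` vertices l"
  proof
    fix x assume "x \<in> Dom l"
    then have "(tfun l x, x) \<in> vertices l" by (simp add: mem_vertices_iff)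
    then show "x \<in> snd ` vertices l" by force
  qed
qed (auto simp: mem_vertices_iff)

lemma subtrace_iff_vertices: "subtrace l l' \<longleftrightarrow> vertices l \<subseteq> vertices l'"
proof
  assume sub: "vertices l \<subseteq> vertices l'"
  have "(tfun l x, x) \<in> vertices l'" if "x \<in> Dom l" for x
    by (rule subsetD[OF sub]) (simp add: mem_vertices_iff that)
  then show "subtrace l l'" by (auto simp: subtrace_def mem_vertices_iff)
qed (auto simp: subtrace_def mem_vertices_iff)

lemma vertices_eq_imp_eq:
  assumes "is_trace l" "is_trace l'" "vertices l = vertices l'"
  shows "l = l'"
proof -
  have D: "Dom l = Dom l'" using assms(3) by (metis snd_vertices)
  have x: "first_x l = first_x l'" and n: "tlen l = tlen l'"
    using D by (auto simp: Dom_def)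
  have v: "vtx l i = vtx l' i" if "i \<le> tlen l" for i
  proof -
    have "vtx l i \<in> vertices l'" using that assms(3) vtx_in_vertices by blast
    then show ?thesis using x by (simp add: mem_vertices_iff vtx_eq_tfun)
  qed
  have "snd l ! i = snd l' ! i" if "i < tlen l" for i
    using v[of i] v[of "Suc i"] that n by (simp add: vtx_Suc)
  then have "snd l = snd l'" using n by (intro nth_equalityI) (auto simp: tlen_def)
  moreover have "fst l = fst l'" using v[of 0] by (simp add: vtx_0)
  ultimately show ?thesis by (simp add: prod_eq_iff)
qed

lemma vertex_in_edge:
  assumes "is_trace l" "p \<in> vertices l"
  obtains e where "e \<in> tedges l" "p = fst e \<or> p = snd e"
proof -
  have tl: "0 < tlen l" using assms(1) by (rule tlen_pos)
  obtain i where i: "i \<le> tlen l" "p = vtx l i" using assms(2) by (auto simp: vertices_def)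
  define k where "k = (if i = 0 then 1 else i)"
  have "tedge l k \<in> tedges l" using i(1) tl by (auto simp: tedges_def k_def)
  moreover have "p = fst (tedge l k) \<or> p = snd (tedge l k)"
    by (auto simp: k_def tedge_def mk_edge_def i(2))
  ultimately show ?thesis by (rule that)
qed

lemma subtrace_iff_tedges:
  assumes "is_trace l" "is_trace l'"
  shows "subtrace l l' \<longleftrightarrow> tedges l \<subseteq> tedges l'"
proof
  assume "tedges l \<subseteq> tedges l'"
  then have "vertices l \<subseteq> vertices l'"
    using vertex_in_edge[OF assms(1)] mem_tedges_iff[OF assms(2)] by (metis subset_iff)
  then show "subtrace l l'" by (simp add: subtrace_iff_vertices)
qed (auto simp: subtrace_iff_vertices mem_tedges_iff assms)

lemma tedges_eq_imp_eq:
  assumes "is_trace l" "is_trace l'" "tedges l = tedges l'"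
  shows "l = l'"
proof -
  have "subtrace l l'" "subtrace l' l" using assms by (simp_all add: subtrace_iff_tedges)
  then show ?thesis using assms(1,2) vertices_eq_imp_eq by (simp add: subtrace_iff_vertices)
qed

lemma first_vertex: "(tfun l (first_x l), first_x l) \<in> vertices l"
  and last_vertex: "(tfun l (last_x l), last_x l) \<in> vertices l"
  by (auto simp: mem_vertices_iff Dom_def)

lemma finite_tedges: "finite (tedges l)"
  by (simp add: tedges_def)

lemma tedges_nonempty: "is_trace l \<Longrightarrow> tedges l \<noteq> {}"
  using tlen_pos[of l] by (auto simp: tedges_def)

lemma tedge_upper:
  assumes "is_trace l" "i < tlen l"
  shows "tedge l (Suc i) = e_nw (vtx l i) \<or> tedge l (Suc i) = e_ne (vtx l i)"
  using trace_step[OF assms] vtx_Suc[OF assms(2)]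
  by (cases "vtx l i") (auto simp: tedge_def mk_edge_def e_nw_def e_ne_def)

lemma tedge_lower:
  assumes "is_trace l" "i < tlen l"
  shows "tedge l (Suc i) = e_sw (vtx l (Suc i)) \<or> tedge l (Suc i) = e_se (vtx l (Suc i))"
  using trace_step[OF assms] vtx_Suc[OF assms(2)]
  by (cases "vtx l i") (auto simp: tedge_def mk_edge_def e_sw_def e_se_def)

lemma finite_box: "finite {(t, x). A \<le> t + x \<and> t + x \<le> B \<and> C \<le> t - x \<and> t - x \<le> (D::int)}"
proof (rule finite_subset)
  show "{(t, x). A \<le> t + x \<and> t + x \<le> B \<and> C \<le> t - x \<and> t - x \<le> D} \<subseteq>
    {-\<bar>A\<bar> - \<bar>C\<bar>..\<bar>B\<bar> + \<bar>D\<bar>} \<times> {-\<bar>A\<bar> - \<bar>D\<bar>..\<bar>B\<bar> + \<bar>C\<bar>}"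
    by auto
qed simp

lemma is_edge_simps [simp]:
  "is_edge (e_ne y)" "is_edge (e_se y)" "is_edge (e_sw y)" "is_edge (e_nw y)"
  by (auto simp: is_edge_def e_ne_def e_se_def e_sw_def e_nw_def split: prod.split)

lemma west_east_simps:
  "west (e_ne (t, x)) = (t, x + 1)" "east (e_ne (t, x)) = (t + 1, x)"
  "west (e_se (t, x)) = (t, x - 1)" "east (e_se (t, x)) = (t + 1, x)"
  "west (e_sw (t, x)) = (t - 1, x)" "east (e_sw (t, x)) = (t, x - 1)"
  "west (e_nw (t, x)) = (t - 1, x)" "east (e_nw (t, x)) = (t, x + 1)"
  by (auto simp: west_def east_def e_ne_def e_se_def e_sw_def e_nw_def)

lemma cone_le_trans: "p \<sqsubseteq> q \<Longrightarrow> q \<sqsubseteq> r \<Longrightarrow> p \<sqsubseteq> r"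
  by (auto simp: cone_le_def)

lemma cone_le_total_same_x: "snd p = snd q \<Longrightarrow> p \<sqsubseteq> q \<or> q \<sqsubseteq> p"
  by (auto simp: cone_le_def)

lemma west_le_east: "is_edge e \<Longrightarrow> west e \<sqsubseteq> east e"
  by (auto simp: cone_le_def is_edge_def west_def east_def)

text \<open>For a trace crossing the domain, the faces in its past are those to its west.\<close>

definition past :: "trace \<Rightarrow> pt set" where
  "past l = {f. \<exists>p\<in>vertices l. f \<sqsubseteq> p}"

lemma past_down_closed: "f \<sqsubseteq> g \<Longrightarrow> g \<in> past l \<Longrightarrow> f \<in> past l"
  unfolding past_def by (blast intro: cone_le_trans)

lemma west_in_past:
  assumes "is_trace l" "e \<in> tedges l"
  shows "west e \<in> past l"
proof -
  have "is_edge e" "snd e \<in> vertices l" using assms mem_tedges_iff by blast+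
  moreover have "west e \<sqsubseteq> snd e"
    using \<open>is_edge e\<close> by (auto simp: cone_le_def west_def is_edge_def)
  ultimately show ?thesis by (auto simp: past_def)
qed

lemma east_notin_past:
  assumes "is_trace l" "e \<in> tedges l"
  shows "east e \<notin> past l"
proof
  assume "east e \<in> past l"
  then obtain p where p: "p \<in> vertices l" "east e \<sqsubseteq> p" by (auto simp: past_def)
  have e: "is_edge e" "fst e \<in> vertices l" using assms mem_tedges_iff by blast+
  show False
    using vertices_lipschitz[OF assms(1) p(1) e(2)] p(2) e(1)
    by (auto simp: cone_le_def east_def is_edge_def)
qed

lemma past_le_tfun:
  assumes "is_trace l" "(t, x) \<in> past l" "x \<in> Dom l"
  shows "t \<le> tfun l x"
proof -
  obtain p where p: "p \<in> vertices l" "(t, x) \<sqsubseteq> p" using assms(2) by (auto simp: past_def)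
  have "(tfun l x, x) \<in> vertices l" using assms(3) by (simp add: mem_vertices_iff)
  from vertices_lipschitz[OF assms(1) p(1) this] show ?thesis
    using p(2) by (auto simp: cone_le_def)
qed

text \<open>A face and a vertex have opposite parity, so a face below a vertex lies below the face directly
  to its west, and that face lies below the western side of every edge at the vertex.\<close>

lemma face_below_vertex:
  assumes "is_edge e" "p = fst e \<or> p = snd e" "f \<sqsubseteq> p" "odd (fst f + snd f)" "even (fst p + snd p)"
  shows "f \<sqsubseteq> west e"
proof -
  have o: "odd (fst f - snd f)" "even (fst p - snd p)" using assms(4,5) by auto
  have "fst f + snd f \<noteq> fst p + snd p" "fst f - snd f \<noteq> fst p - snd p"
    using assms(4,5) o by metis+
  then have "fst f + snd f + 1 \<le> fst p + snd p" "fst f - snd f + 1 \<le> fst p - snd p"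
    using assms(3) by (auto simp: cone_le_def)
  then show ?thesis using assms(1,2) by (auto simp: cone_le_def west_def is_edge_def)
qed

lemma face_above_vertex:
  assumes "is_edge e" "p = fst e \<or> p = snd e" "p \<sqsubseteq> f" "odd (fst f + snd f)" "even (fst p + snd p)"
  shows "east e \<sqsubseteq> f"
proof -
  have o: "odd (fst f - snd f)" "even (fst p - snd p)" using assms(4,5) by auto
  have "fst f + snd f \<noteq> fst p + snd p" "fst f - snd f \<noteq> fst p - snd p"
    using assms(4,5) o by metis+
  then have "fst p + snd p + 1 \<le> fst f + snd f" "fst p - snd p + 1 \<le> fst f - snd f"
    using assms(3) by (auto simp: cone_le_def)
  then show ?thesis using assms(1,2) by (auto simp: cone_le_def east_def is_edge_def)
qed

subsection \<open>Traces across a rectangular domain\<close>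

locale rect =
  fixes a b c d :: int
  assumes ev: "even a" "even b" "even c" "even d" and ab: "a \<le> b" and cd: "c \<le> d"
begin

abbreviation S where "S \<equiv> rect_domain a b c d"

definition faces :: "pt set" where
  "faces = {(t, x). odd (t + x) \<and> a - 1 \<le> t + x \<and> t + x \<le> b + 1 \<and> c - 1 \<le> t - x \<and> t - x \<le> d + 1}"

lemma mem_S: "(t, x) \<in> S \<longleftrightarrow> even (t + x) \<and> a \<le> t + x \<and> t + x \<le> b \<and> c \<le> t - x \<and> t - x \<le> d"
  by (simp add: rect_domain_def)

lemma mem_faces:
  "(t, x) \<in> faces \<longleftrightarrow> odd (t + x) \<and> a - 1 \<le> t + x \<and> t + x \<le> b + 1 \<and> c - 1 \<le> t - x \<and> t - x \<le> d + 1"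
  by (simp add: faces_def)

lemma faces_odd: "f \<in> faces \<Longrightarrow> odd (fst f + snd f)"
  by (auto simp: faces_def)

lemma bdry_cases:
  assumes "(t, x) \<in> bdry S"
  shows "even (t + x) \<and>
    ((t + x = a - 2 \<or> t + x = b + 2) \<and> c \<le> t - x \<and> t - x \<le> d \<or>
     (t - x = c - 2 \<or> t - x = d + 2) \<and> a \<le> t + x \<and> t + x \<le> b)"
proof -
  obtain t' x' where y: "(t', x') \<in> S" "(t, x) \<in> nbrs (t', x')" and n: "(t, x) \<notin> S"
    using assms by (auto simp: bdry_def closure_dom_def)
  have y': "t' + x' \<ge> a" "t' + x' \<le> b" "t' - x' \<ge> c" "t' - x' \<le> d" "even (t' + x')"
    using y(1) by (auto simp: mem_S)
  have ev': "even (t + x)" using y(2) y'(5) by (auto simp: nbrs_def)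
  have n': "\<not> (a \<le> t + x \<and> t + x \<le> b \<and> c \<le> t - x \<and> t - x \<le> d)"
    using n ev' by (simp add: mem_S)
  have e2: "even (t' - x')" using y'(5) by simp
  have k: "t' + x' = a \<or> a + 2 \<le> t' + x'" "t' + x' = b \<or> t' + x' \<le> b - 2"
    "t' - x' = c \<or> c + 2 \<le> t' - x'" "t' - x' = d \<or> t' - x' \<le> d - 2"
    using y' e2 ev by presburger+
  from y(2) consider "t = t' + 1" "x = x' + 1" | "t = t' + 1" "x = x' - 1"
    | "t = t' - 1" "x = x' - 1" | "t = t' - 1" "x = x' + 1"
    by (auto simp: nbrs_def)
  then show ?thesis using ev' n' y' k by cases auto
qed

lemma in_bdryI:
  assumes "y \<in> S" "y' \<in> nbrs y" "y' \<notin> S"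
  shows "y' \<in> bdry S"
  using assms by (auto simp: bdry_def closure_dom_def)

lemma edges_dom_cases:
  assumes "e \<in> edges_dom S"
  obtains y where "y \<in> S" "e = e_ne y \<or> e = e_se y \<or> e = e_sw y \<or> e = e_nw y"
  using assms by (auto simp: edges_dom_def)

lemma edges_dom_is_edge: "e \<in> edges_dom S \<Longrightarrow> is_edge e"
  by (auto elim!: edges_dom_cases)

lemma edges_dom_endpoint: "e \<in> edges_dom S \<Longrightarrow> fst e \<in> S \<or> snd e \<in> S"
  by (force elim!: edges_dom_cases simp: e_ne_def e_se_def e_sw_def e_nw_def)

lemma edges_domI:
  assumes "is_edge e" "fst e \<in> S \<or> snd e \<in> S"
  shows "e \<in> edges_dom S"
proof -
  obtain t x t' x' where e: "e = ((t, x), (t', x'))" by (metis prod.collapse)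
  have tx: "t' = t + 1" "x' = x + 1 \<or> x' = x - 1" using assms(1) by (auto simp: e is_edge_def)
  from assms(2) show ?thesis
  proof
    assume "fst e \<in> S"
    moreover have "e = e_ne (fst e) \<or> e = e_se (fst e)"
      using tx by (auto simp: e e_ne_def e_se_def)
    ultimately show ?thesis unfolding edges_dom_def by blast
  next
    assume "snd e \<in> S"
    moreover have "e = e_nw (snd e) \<or> e = e_sw (snd e)"
      using tx by (auto simp: e e_nw_def e_sw_def)
    ultimately show ?thesis unfolding edges_dom_def by blast
  qed
qed

lemma mem_S_edges_dom:
  assumes "y \<in> S"
  shows "e_ne y \<in> edges_dom S" "e_se y \<in> edges_dom S" "e_sw y \<in> edges_dom S" "e_nw y \<in> edges_dom S"
  using assms by (auto simp: edges_dom_def)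

lemma edges_dom_faces:
  assumes "e \<in> edges_dom S"
  shows "west e \<in> faces" "east e \<in> faces"
proof -
  obtain t x t' x' where e: "e = ((t, x), (t', x'))" by (metis prod.collapse)
  have tx: "t' = t + 1" "x' = x + 1 \<or> x' = x - 1"
    using edges_dom_is_edge[OF assms] by (auto simp: e is_edge_def)
  have "(t, x) \<in> S \<or> (t', x') \<in> S" using edges_dom_endpoint[OF assms] by (simp add: e)
  then show "west e \<in> faces" "east e \<in> faces"
    using tx by (auto simp: e west_def east_def mem_faces mem_S)
qed

lemma Ctr_trace: "l \<in> Ctr S \<Longrightarrow> is_trace l"
  by (simp add: Ctr_def)

lemma Ctr_closure: "l \<in> Ctr S \<Longrightarrow> in_closure S l"
  by (simp add: Ctr_def)

lemma tedges_subset_edges_dom: "in_closure S l \<Longrightarrow> tedges l \<subseteq> edges_dom S"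
  by (auto simp: in_closure_def tedges_def)

lemma Ctr_edges: "l \<in> Ctr S \<Longrightarrow> tedges l \<subseteq> edges_dom S"
  using tedges_subset_edges_dom by (auto simp: Ctr_def)

lemma Ctr_interior:
  assumes "l \<in> Ctr S" "first_x l < x" "x < last_x l"
  shows "(tfun l x, x) \<in> S"
proof -
  define i where "i = nat (x - first_x l)"
  have i: "x = first_x l + int i" "1 \<le> i" "i < tlen l" using assms by (auto simp: i_def)
  have "vtx l i \<in> S" using assms(1) i by (auto simp: Ctr_def in_closure_def)
  then show ?thesis by (simp add: vtx_eq_tfun i(1))
qed

lemma Ctr_first_last_lt:
  assumes "l \<in> Ctr S"
  shows "first_x l + 1 < last_x l"
proof (rule ccontr)
  have tr: "is_trace l" using assms by (rule Ctr_trace)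
  assume "\<not> first_x l + 1 < last_x l"
  then have n: "tlen l = 1" using tlen_pos[OF tr] by linarith
  have "tedge l 1 \<in> edges_dom S" using assms n by (auto simp: Ctr_def in_closure_def)
  then have "vtx l 0 \<in> S \<or> vtx l 1 \<in> S"
    using edges_dom_endpoint[of "tedge l 1"] by (auto simp: tedge_def mk_edge_def split: if_splits)
  then show False using assms n by (auto simp: Ctr_def bdry_def)
qed

lemma Ctr_start:
  assumes "l \<in> Ctr S" and "t = tfun l (first_x l)" and "x = first_x l"
  shows "(t + x = a - 2 \<and> c \<le> t - x \<and> t - x \<le> d) \<or> (t - x = d + 2 \<and> a \<le> t + x \<and> t + x \<le> b)"
proof -
  have tr: "is_trace l" and lt: "x + 1 < last_x l"
    using assms Ctr_trace Ctr_first_last_lt by auto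
  have "vtx l 0 \<in> bdry S" using assms(1) by (simp add: Ctr_def)
  then have "(t, x) \<in> bdry S" using vtx_eq_tfun[of l 0] assms by simp
  note B = bdry_cases[OF this]
  have "(tfun l (x + 1), x + 1) \<in> S" using Ctr_interior[OF assms(1)] lt assms(3) by auto
  moreover have "tfun l (x + 1) = t + 1 \<or> tfun l (x + 1) = t - 1"
    using tfun_step[OF tr, of x] lt assms by auto
  ultimately show ?thesis using B by (auto simp: mem_S)
qed

lemma Ctr_end:
  assumes "l \<in> Ctr S" and "t = tfun l (last_x l)" and "x = last_x l"
  shows "(t + x = b + 2 \<and> c \<le> t - x \<and> t - x \<le> d) \<or> (t - x = c - 2 \<and> a \<le> t + x \<and> t + x \<le> b)"
proof -
  have tr: "is_trace l" and lt: "first_x l + 1 < x"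
    using assms Ctr_trace Ctr_first_last_lt by auto
  have "vtx l (tlen l) \<in> bdry S" using assms(1) by (simp add: Ctr_def)
  then have "(t, x) \<in> bdry S" using vtx_eq_tfun[of l "tlen l"] assms by simp
  note B = bdry_cases[OF this]
  have "(tfun l (x - 1), x - 1) \<in> S" using Ctr_interior[OF assms(1), of "x - 1"] lt assms(3) by auto
  moreover have "t = tfun l (x - 1) + 1 \<or> t = tfun l (x - 1) - 1"
    using tfun_step[OF tr, of "x - 1"] lt assms by auto
  ultimately show ?thesis using B by (auto simp: mem_S)
qed

lemma Ctr_bounds:
  assumes "l \<in> Ctr S" "(t, x) \<in> vertices l"
  shows "a - 2 \<le> t + x" "t + x \<le> b + 2" "c - 2 \<le> t - x" "t - x \<le> d + 2"
proof -
  have x: "first_x l \<le> x" "x \<le> last_x l" "t = tfun l x"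
    using assms(2) by (auto simp: mem_vertices_iff Dom_def)
  consider "x = first_x l" | "x = last_x l" | "first_x l < x" "x < last_x l" using x by linarith
  then have "a - 2 \<le> t + x \<and> t + x \<le> b + 2 \<and> c - 2 \<le> t - x \<and> t - x \<le> d + 2"
  proof cases
    case 1
    then show ?thesis using Ctr_start[OF assms(1), of t x] x(3) ab cd by auto
  next
    case 2
    then show ?thesis using Ctr_end[OF assms(1), of t x] x(3) ab cd by auto
  next
    case 3
    then show ?thesis using Ctr_interior[OF assms(1), of x] x(3) by (auto simp: mem_S)
  qed
  then show "a - 2 \<le> t + x" "t + x \<le> b + 2" "c - 2 \<le> t - x" "t - x \<le> d + 2" by auto
qed

lemma Ctr_after_start:
  assumes "l \<in> Ctr S" "(t, x) \<in> vertices l" "first_x l < x"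
  shows "a \<le> t + x" "t - x \<le> d"
proof -
  have x: "x \<le> last_x l" "t = tfun l x"
    using assms(2) by (auto simp: mem_vertices_iff Dom_def)
  have "a \<le> t + x \<and> t - x \<le> d"
    using Ctr_end[OF assms(1), of t x] Ctr_interior[OF assms(1), of x] x assms(3) ab cd
    by (cases "x = last_x l") (auto simp: mem_S)
  then show "a \<le> t + x" "t - x \<le> d" by auto
qed

lemma Ctr_before_end:
  assumes "l \<in> Ctr S" "(t, x) \<in> vertices l" "x < last_x l"
  shows "t + x \<le> b" "c \<le> t - x"
proof -
  have x: "first_x l \<le> x" "t = tfun l x"
    using assms(2) by (auto simp: mem_vertices_iff Dom_def)
  have "t + x \<le> b \<and> c \<le> t - x"
    using Ctr_start[OF assms(1), of t x] Ctr_interior[OF assms(1), of x] x assms(3) ab cd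
    by (cases "x = first_x l") (auto simp: mem_S)
  then show "t + x \<le> b" "c \<le> t - x" by auto
qed

lemma face_comparable:
  assumes "l \<in> Ctr S" "f \<in> faces"
  shows "\<exists>p\<in>vertices l. f \<sqsubseteq> p \<or> p \<sqsubseteq> f"
proof -
  obtain t x where f: "f = (t, x)" by fastforce
  note F = assms(2)[unfolded f mem_faces]
  consider "x \<in> Dom l" | "x < first_x l" | "x > last_x l"
    unfolding Dom_def atLeastAtMost_iff by linarith
  then show ?thesis
  proof cases
    case 1
    then have "(tfun l x, x) \<in> vertices l" by (simp add: mem_vertices_iff)
    then show ?thesis using cone_le_total_same_x[of f "(tfun l x, x)"] f by auto
  next
    case 2
    then have "f \<sqsubseteq> (tfun l (first_x l), first_x l) \<or> (tfun l (first_x l), first_x l) \<sqsubseteq> f"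
      using Ctr_start[OF assms(1) refl refl] F unfolding f cone_le_def fst_conv snd_conv
      by linarith
    then show ?thesis using first_vertex by blast
  next
    case 3
    then have "f \<sqsubseteq> (tfun l (last_x l), last_x l) \<or> (tfun l (last_x l), last_x l) \<sqsubseteq> f"
      using Ctr_end[OF assms(1) refl refl] F unfolding f cone_le_def fst_conv snd_conv
      by linarith
    then show ?thesis using last_vertex by blast
  qed
qed

lemma past_imp_le_west:
  assumes "l \<in> Ctr S" "f \<in> faces" "f \<in> past l"
  shows "\<exists>e\<in>tedges l. f \<sqsubseteq> west e"
proof -
  have tr: "is_trace l" using assms(1) by (rule Ctr_trace)
  obtain p where p: "p \<in> vertices l" "f \<sqsubseteq> p" using assms(3) by (auto simp: past_def)
  obtain e where e: "e \<in> tedges l" "p = fst e \<or> p = snd e" using vertex_in_edge[OF tr p(1)] .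
  have "is_edge e" using e(1) mem_tedges_iff[OF tr] by blast
  then show ?thesis
    using face_below_vertex e p vertices_even[OF tr p(1)] faces_odd[OF assms(2)] by blast
qed

lemma notin_past_imp_east_le:
  assumes "l \<in> Ctr S" "f \<in> faces" "f \<notin> past l"
  shows "\<exists>e\<in>tedges l. east e \<sqsubseteq> f"
proof -
  have tr: "is_trace l" using assms(1) by (rule Ctr_trace)
  obtain p where p: "p \<in> vertices l" "p \<sqsubseteq> f"
    using face_comparable[OF assms(1,2)] assms(3) by (auto simp: past_def)
  obtain e where e: "e \<in> tedges l" "p = fst e \<or> p = snd e" using vertex_in_edge[OF tr p(1)] .
  have "is_edge e" using e(1) mem_tedges_iff[OF tr] by blast
  then show ?thesis
    using face_above_vertex e p vertices_even[OF tr p(1)] faces_odd[OF assms(2)] by blast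
qed

lemma mem_tedges_iff_past:
  assumes "l \<in> Ctr S" "e \<in> edges_dom S"
  shows "e \<in> tedges l \<longleftrightarrow> west e \<in> past l \<and> east e \<notin> past l"
proof
  have tr: "is_trace l" using assms(1) by (rule Ctr_trace)
  show "e \<in> tedges l \<Longrightarrow> west e \<in> past l \<and> east e \<notin> past l"
    using west_in_past east_notin_past tr by blast
  assume *: "west e \<in> past l \<and> east e \<notin> past l"
  obtain t x t' x' where e: "e = ((t, x), (t', x'))" by (metis prod.collapse)
  have ie: "is_edge e" using edges_dom_is_edge[OF assms(2)] .
  have tx: "t' = t + 1" "x' = x + 1 \<or> x' = x - 1" using ie by (auto simp: e is_edge_def)
  have F: "(t, x') \<in> faces" "(t + 1, x) \<in> faces"
    using edges_dom_faces[OF assms(2)] tx by (auto simp: e west_def east_def)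
  have W: "(t, x') \<in> past l" and E: "(t + 1, x) \<notin> past l"
    using * tx by (auto simp: e west_def east_def)
  obtain p q where p: "(p, q) \<in> vertices l" "(t, x') \<sqsubseteq> (p, q)" using W by (auto simp: past_def)
  have E': "\<not> (t + 1, x) \<sqsubseteq> (tfun l (first_x l), first_x l)" "\<not> (t + 1, x) \<sqsubseteq> (tfun l (last_x l), last_x l)"
    using E first_vertex last_vertex by (auto simp: past_def)
  have lo: "first_x l \<le> x \<and> first_x l \<le> x'"
  proof (rule ccontr)
    assume "\<not> ?thesis"
    then have lt: "x \<le> first_x l" "x' \<le> first_x l" using tx(2) by auto
    show False
      using Ctr_start[OF assms(1) refl refl] vertices_lipschitz[OF tr p(1) first_vertex] p(2) E'(1) F lt
      unfolding cone_le_def fst_conv snd_conv mem_faces by linarith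
  qed
  have hi: "x \<le> last_x l \<and> x' \<le> last_x l"
  proof (rule ccontr)
    assume "\<not> ?thesis"
    then have lt: "last_x l \<le> x" "last_x l \<le> x'" using tx(2) by auto
    show False
      using Ctr_end[OF assms(1) refl refl] vertices_lipschitz[OF tr p(1) last_vertex] p(2) E'(2) F lt
      unfolding cone_le_def fst_conv snd_conv mem_faces by linarith
  qed
  have D: "x \<in> Dom l" "x' \<in> Dom l" using lo hi by (auto simp: Dom_def)
  then have V: "(tfun l x, x) \<in> vertices l" "(tfun l x', x') \<in> vertices l"
    by (auto simp: mem_vertices_iff)
  have "\<not> (t + 1, x) \<sqsubseteq> (tfun l x, x)" using E V by (auto simp: past_def)
  then have 1: "tfun l x \<le> t" by (auto simp: cone_le_def)
  have "t \<le> tfun l x'" using past_le_tfun[OF tr W D(2)] .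
  moreover have "t \<noteq> tfun l x'"
    using tfun_even[OF tr D(2)] F(1) by (auto simp: mem_faces)
  ultimately have 2: "t + 1 \<le> tfun l x'" by linarith
  have "tfun l x = t" "tfun l x' = t + 1"
    using 1 2 vertices_lipschitz[OF tr V] tx(2) by auto
  then show "e \<in> tedges l" using V ie tx by (simp add: mem_tedges_iff[OF tr] e)
qed

lemma tsucceq_imp_past_subset:
  assumes "l \<in> Ctr S" "l' \<in> Ctr S" "tsucceq l l'"
  shows "past l' \<inter> faces \<subseteq> past l"
proof
  fix f assume f0: "f \<in> past l' \<inter> faces"
  have tr: "is_trace l" "is_trace l'" using assms(1,2) by (auto intro: Ctr_trace)
  obtain t x where f: "f = (t, x)" by fastforce
  have F: "(t, x) \<in> faces" using f0 f by simp
  obtain t' x' where y': "(t', x') \<in> vertices l'" "(t, x) \<sqsubseteq> (t', x')"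
    using f0 by (auto simp: f past_def)
  have y'D: "first_x l' \<le> x'" "x' \<le> last_x l'" using y'(1) by (auto simp: mem_vertices_iff Dom_def)
  have ge: "tfun l' z \<le> tfun l z" if "z \<in> Dom l" "z \<in> Dom l'" for z
    using assms(3) that by (auto simp: tsucceq_def)
  obtain p q where pq: "p \<in> Dom l" "q \<in> Dom l'" "tfun l' q \<le> tfun l p"
    using assms(3) by (auto simp: tsucceq_def)
  have pV: "(tfun l p, p) \<in> vertices l" and qV: "(tfun l' q, q) \<in> vertices l'"
    using pq by (auto simp: mem_vertices_iff)
  show "f \<in> past l"
  proof (rule ccontr)
    assume nf: "f \<notin> past l"
    then have N: "\<not> (t, x) \<sqsubseteq> (tfun l z, z)" if "z \<in> Dom l" for z
      using that by (auto simp: f past_def mem_vertices_iff)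
    consider "x' \<in> Dom l" | "x' < first_x l" | "x' > last_x l"
      unfolding Dom_def atLeastAtMost_iff by linarith
    then show False
    proof cases
      case 1
      then show False
        using N[OF 1] ge[OF 1] y' by (auto simp: mem_vertices_iff cone_le_def)
    next
      case 2
      define t0 x0 t1 x1 where "t0 = tfun l (first_x l)" "x0 = first_x l"
        "t1 = tfun l' (last_x l')" "x1 = last_x l'"
      note defs = this
      have N0: "\<not> (t, x) \<sqsubseteq> (t0, x0)" using N[of x0] by (simp add: defs Dom_def)
      have st: "(t0 + x0 = a - 2 \<and> c \<le> t0 - x0 \<and> t0 - x0 \<le> d) \<or> (t0 - x0 = d + 2 \<and> a \<le> t0 + x0 \<and> t0 + x0 \<le> b)"
        using Ctr_start[OF assms(1)] defs by blast
      have en: "(t1 + x1 = b + 2 \<and> c \<le> t1 - x1 \<and> t1 - x1 \<le> d) \<or> (t1 - x1 = c - 2 \<and> a \<le> t1 + x1 \<and> t1 + x1 \<le> b)"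
        using Ctr_end[OF assms(2)] defs by blast
      show False
      proof (cases "x0 \<in> Dom l'")
        case True
        have v: "(tfun l' x0, x0) \<in> vertices l'" using True by (simp add: mem_vertices_iff)
        have "tfun l' x0 \<le> t0" using ge[of x0] True by (simp add: defs Dom_def)
        moreover have "a \<le> tfun l' x0 + x0" using Ctr_after_start(1)[OF assms(2) v] y'D 2 defs by simp
        ultimately show False
          using st N0 vertices_lipschitz[OF tr(2) v y'(1)] y'(2) F 2
          unfolding cone_le_def fst_conv snd_conv mem_faces defs(2) by linarith
      next
        case False
        then have x1: "x1 < x0" using y'D 2 by (auto simp: Dom_def defs)
        have v1: "(t1, x1) \<in> vertices l'" using last_vertex defs by simp
        have v0: "(t0, x0) \<in> vertices l" using first_vertex defs by simp
        have qx: "q \<le> x1" using pq(2) by (simp add: Dom_def defs)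
        have px: "x0 \<le> p" using pq(1) by (simp add: Dom_def defs)
        have xx: "x' \<le> x1" using y'D by (simp add: defs)
        show False
          using st en N0 vertices_lipschitz[OF tr(2) v1 y'(1)] y'(2) F x1 xx qx px pq(3)
            vertices_lipschitz[OF tr(2) v1 qV] vertices_lipschitz[OF tr(1) v0 pV]
            Ctr_bounds[OF assms(1) pV] Ctr_bounds[OF assms(2) qV]
          unfolding cone_le_def fst_conv snd_conv mem_faces by linarith
      qed
    next
      case 3
      define t0 x0 t1 x1 where "t0 = tfun l (last_x l)" "x0 = last_x l"
        "t1 = tfun l' (first_x l')" "x1 = first_x l'"
      note defs = this
      have N0: "\<not> (t, x) \<sqsubseteq> (t0, x0)" using N[of x0] by (simp add: defs Dom_def)
      have en: "(t0 + x0 = b + 2 \<and> c \<le> t0 - x0 \<and> t0 - x0 \<le> d) \<or> (t0 - x0 = c - 2 \<and> a \<le> t0 + x0 \<and> t0 + x0 \<le> b)"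
        using Ctr_end[OF assms(1)] defs by blast
      have st: "(t1 + x1 = a - 2 \<and> c \<le> t1 - x1 \<and> t1 - x1 \<le> d) \<or> (t1 - x1 = d + 2 \<and> a \<le> t1 + x1 \<and> t1 + x1 \<le> b)"
        using Ctr_start[OF assms(2)] defs by blast
      show False
      proof (cases "x0 \<in> Dom l'")
        case True
        have v: "(tfun l' x0, x0) \<in> vertices l'" using True by (simp add: mem_vertices_iff)
        have "tfun l' x0 \<le> t0" using ge[of x0] True by (simp add: defs Dom_def)
        moreover have "c \<le> tfun l' x0 - x0" using Ctr_before_end(2)[OF assms(2) v] y'D 3 defs by simp
        ultimately show False
          using en N0 vertices_lipschitz[OF tr(2) v y'(1)] y'(2) F 3
          unfolding cone_le_def fst_conv snd_conv mem_faces defs(2) by linarith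
      next
        case False
        then have x1: "x0 < x1" using y'D 3 by (auto simp: Dom_def defs)
        have v1: "(t1, x1) \<in> vertices l'" using first_vertex defs by simp
        have v0: "(t0, x0) \<in> vertices l" using last_vertex defs by simp
        have qx: "x1 \<le> q" using pq(2) by (simp add: Dom_def defs)
        have px: "p \<le> x0" using pq(1) by (simp add: Dom_def defs)
        have xx: "x1 \<le> x'" using y'D by (simp add: defs)
        show False
          using st en N0 vertices_lipschitz[OF tr(2) v1 y'(1)] y'(2) F x1 xx qx px pq(3)
            vertices_lipschitz[OF tr(2) v1 qV] vertices_lipschitz[OF tr(1) v0 pV]
            Ctr_bounds[OF assms(1) pV] Ctr_bounds[OF assms(2) qV]
          unfolding cone_le_def fst_conv snd_conv mem_faces by linarith
      qed
    qed
  qed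
qed

lemma past_subset_imp_tsucceq:
  assumes "l \<in> Ctr S" "l' \<in> Ctr S" "past l' \<inter> faces \<subseteq> past l"
  shows "tsucceq l l'"
proof -
  have tr: "is_trace l" "is_trace l'" using assms(1,2) by (auto intro: Ctr_trace)
  have "tfun l' x \<le> tfun l x" if x: "x \<in> Dom l" "x \<in> Dom l'" for x
  proof (rule ccontr)
    assume *: "\<not> tfun l' x \<le> tfun l x"
    have v: "(tfun l x, x) \<in> vertices l" and v': "(tfun l' x, x) \<in> vertices l'"
      using x by (auto simp: mem_vertices_iff)
    have e: "even (tfun l x + x)" "even (tfun l' x + x)" using tfun_even tr x by auto
    have "tfun l x \<noteq> tfun l' x - 1" using e by presburger
    then have lt: "tfun l x < tfun l' x - 1" using * by linarith
    have "odd (tfun l' x - 1 + x)" using e by presburger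
    then have "(tfun l' x - 1, x) \<in> faces"
      using Ctr_bounds[OF assms(1) v] Ctr_bounds[OF assms(2) v'] lt by (auto simp: mem_faces)
    moreover have "(tfun l' x - 1, x) \<in> past l'"
      using v' by (auto simp: past_def cone_le_def intro!: bexI[of _ "(tfun l' x, x)"])
    ultimately have "(tfun l' x - 1, x) \<in> past l" using assms(3) by blast
    from past_le_tfun[OF tr(1) this x(1)] lt show False by simp
  qed
  moreover have "\<exists>x\<in>Dom l. \<exists>x'\<in>Dom l'. tfun l x \<ge> tfun l' x'"
  proof -
    obtain e where e: "e \<in> tedges l'" using vertex_in_edge[OF tr(2) first_vertex] by blast
    obtain t x t' x' where ee: "e = ((t, x), (t', x'))" by (metis prod.collapse)
    have "west e \<in> past l' \<inter> faces"
      using west_in_past[OF tr(2) e] edges_dom_faces(1) Ctr_edges[OF assms(2)] e by blast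
    then have "(t, x') \<in> past l" using assms(3) by (auto simp: west_def ee)
    then obtain p q where pq: "(p, q) \<in> vertices l" "(t, x') \<sqsubseteq> (p, q)" by (auto simp: past_def)
    have "(t, x) \<in> vertices l'" using e mem_tedges_iff[OF tr(2)] by (auto simp: ee)
    then show ?thesis using pq
      by (intro bexI[of _ q] bexI[of _ x]) (auto simp: mem_vertices_iff cone_le_def)
  qed
  ultimately show ?thesis by (auto simp: tsucceq_def)
qed

lemma tsucceq_iff_past:
  "l \<in> Ctr S \<Longrightarrow> l' \<in> Ctr S \<Longrightarrow> tsucceq l l' \<longleftrightarrow> past l' \<inter> faces \<subseteq> past l \<inter> faces"
  using tsucceq_imp_past_subset past_subset_imp_tsucceq by blast

lemma past_inj:
  assumes "l \<in> Ctr S" "l' \<in> Ctr S" "past l \<inter> faces = past l' \<inter> faces"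
  shows "l = l'"
proof (rule tedges_eq_imp_eq)
  have "e \<in> tedges l \<longleftrightarrow> e \<in> tedges l'" if "e \<in> edges_dom S" for e
    using mem_tedges_iff_past[OF assms(1) that] mem_tedges_iff_past[OF assms(2) that]
      edges_dom_faces[OF that] assms(3) by blast
  then show "tedges l = tedges l'" using Ctr_edges assms(1,2) by blast
qed (use assms Ctr_trace in auto)

lemma finite_faces: "finite faces"
  by (rule finite_subset[OF _ finite_box[of "a - 1" "b + 1" "c - 1" "d + 1"]]) (auto simp: faces_def)

lemma finite_Ctr: "finite (Ctr S)"
proof (rule inj_on_finite)
  let ?B = "{(t, x). a - 2 \<le> t + x \<and> t + x \<le> b + 2 \<and> c - 2 \<le> t - x \<and> t - x \<le> d + 2}"
  show "inj_on vertices (Ctr S)" by (intro inj_onI) (auto dest: vertices_eq_imp_eq[OF Ctr_trace Ctr_trace])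
  show "vertices ` Ctr S \<subseteq> Pow ?B" using Ctr_bounds by auto
  show "finite (Pow ?B)" using finite_box by simp
qed

end

subsection \<open>Level traces of a potential\<close>

lemma discrete_ivt:
  fixes g :: "nat \<Rightarrow> real"
  assumes "g 0 < s" "s \<le> g n"
  shows "\<exists>k<n. g k < s \<and> s \<le> g (Suc k)"
  using assms(2)
proof (induction n)
  case 0
  then show ?case using assms(1) by simp
next
  case (Suc n)
  then show ?case by (cases "s \<le> g n") (auto simp: less_Suc_eq)
qed

locale rect_potential = rect +
  fixes h :: "pt \<Rightarrow> real" and \<eta> :: "edge \<Rightarrow> real"
  assumes pot: "e \<in> edges_dom S \<Longrightarrow> \<eta> e = h (east e) - h (west e)"
    and nonneg: "e \<in> edges_dom S \<Longrightarrow> 0 \<le> \<eta> e"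
begin

lemma h_west_le_east: "e \<in> edges_dom S \<Longrightarrow> h (west e) \<le> h (east e)"
  using pot nonneg by fastforce

lemma h_step_north:
  assumes "(t, x) \<in> faces" "(t + 1, x + 1) \<in> faces"
  shows "h (t, x) \<le> h (t + 1, x + 1)"
proof -
  have o: "odd (t + x)" using assms by (simp add: mem_faces)
  have e: "even (t - x + 1)" using o by presburger
  have u: "a \<le> t + x + 1" "t + x + 1 \<le> b" using assms by (auto simp: mem_faces)
  have v: "c \<le> t - x + 1" "t - x - 1 \<le> d" using assms by (auto simp: mem_faces)
  have "t - x + 1 \<le> d \<or> c \<le> t - x - 1" using e ev cd by presburger
  then have "(t, x + 1) \<in> S \<or> (t + 1, x) \<in> S" using o u v by (auto simp: mem_S)
  then have "((t, x + 1), (t + 1, x)) \<in> edges_dom S" by (intro edges_domI) (auto simp: is_edge_def)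
  from h_west_le_east[OF this] show ?thesis by (simp add: west_def east_def)
qed

lemma h_step_south:
  assumes "(t, x) \<in> faces" "(t + 1, x - 1) \<in> faces"
  shows "h (t, x) \<le> h (t + 1, x - 1)"
proof -
  have o: "odd (t + x)" using assms by (simp add: mem_faces)
  have e: "even (t + x + 1)" using o by presburger
  have u: "c \<le> t - x + 1" "t - x + 1 \<le> d" using assms by (auto simp: mem_faces)
  have v: "a \<le> t + x + 1" "t + x - 1 \<le> b" using assms by (auto simp: mem_faces)
  have "t + x + 1 \<le> b \<or> a \<le> t + x - 1" using e ev ab by presburger
  then have "(t, x - 1) \<in> S \<or> (t + 1, x) \<in> S" using o u v by (auto simp: mem_S)
  then have "((t, x - 1), (t + 1, x)) \<in> edges_dom S" by (intro edges_domI) (auto simp: is_edge_def)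
  from h_west_le_east[OF this] show ?thesis by (simp add: west_def east_def)
qed

lemma h_north:
  "(t, x) \<in> faces \<Longrightarrow> (t + int k, x + int k) \<in> faces \<Longrightarrow> h (t, x) \<le> h (t + int k, x + int k)"
proof (induction k)
  case (Suc k)
  have "(t + int k, x + int k) \<in> faces" using Suc.prems by (auto simp: mem_faces)
  then show ?case
    using Suc h_step_north[of "t + int k" "x + int k"] by (simp add: algebra_simps)
qed simp

lemma h_south:
  "(t, x) \<in> faces \<Longrightarrow> (t + int k, x - int k) \<in> faces \<Longrightarrow> h (t, x) \<le> h (t + int k, x - int k)"
proof (induction k)
  case (Suc k)
  have "(t + int k, x - int k) \<in> faces" using Suc.prems by (auto simp: mem_faces)
  then show ?case
    using Suc h_step_south[of "t + int k" "x - int k"] by (simp add: algebra_simps)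
qed simp

lemma h_mono:
  assumes "f \<in> faces" "g \<in> faces" "f \<sqsubseteq> g"
  shows "h f \<le> h g"
proof -
  obtain t x t' x' where fg: "f = (t, x)" "g = (t', x')" by fastforce
  have o: "odd (t + x)" "odd (t' + x')" using assms by (auto simp: fg mem_faces)
  have le: "t + x \<le> t' + x'" "t - x \<le> t' - x'" using assms(3) by (auto simp: fg cone_le_def)
  have "even (t' + x' - (t + x))" "even (t' - x' - (t - x))" using o by presburger+
  then obtain k m where km: "t' + x' - (t + x) = 2 * k" "t' - x' - (t - x) = 2 * m" by (elim evenE)
  have km0: "0 \<le> k" "0 \<le> m" using le km by auto
  have g: "t' = t + k + m" "x' = x + k - m" using km by auto
  have mid: "(t + k, x + k) \<in> faces"
    using assms(1,2) km0 o by (auto simp: fg mem_faces g)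
  have "h (t, x) \<le> h (t + k, x + k)"
    using h_north[of t x "nat k"] mid assms(1) km0 fg by simp
  also have "\<dots> \<le> h (t', x')"
    using h_south[of "t + k" "x + k" "nat m"] mid assms(2) km0 fg g by simp
  finally show ?thesis by (simp add: fg)
qed

definition crosses :: "real \<Rightarrow> edge \<Rightarrow> bool" where
  "crosses s e \<longleftrightarrow> h (west e) < s \<and> s \<le> h (east e)"

lemma level_past:
  assumes "l \<in> Ctr S" "\<forall>e\<in>tedges l. crosses s e"
  shows "past l \<inter> faces = {f \<in> faces. h f < s}"
proof -
  have "f \<in> past l \<longleftrightarrow> h f < s" if f: "f \<in> faces" for f
  proof (cases "f \<in> past l")
    case True
    then obtain e where e: "e \<in> tedges l" "f \<sqsubseteq> west e"
      using past_imp_le_west[OF assms(1) f] by blast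
    then have "h f \<le> h (west e)"
      using h_mono f edges_dom_faces(1) Ctr_edges[OF assms(1)] by blast
    then show ?thesis using True e assms(2) by (auto simp: crosses_def)
  next
    case False
    then obtain e where e: "e \<in> tedges l" "east e \<sqsubseteq> f"
      using notin_past_imp_east_le[OF assms(1) f] by blast
    then have "h (east e) \<le> h f"
      using h_mono f edges_dom_faces(2) Ctr_edges[OF assms(1)] by blast
    then show ?thesis using False e assms(2) by (force simp: crosses_def)
  qed
  then show ?thesis by blast
qed

lemma crosses_imp_mem:
  assumes "l \<in> Ctr S" "\<forall>e\<in>tedges l. crosses s e" "e \<in> edges_dom S" "crosses s e"
  shows "e \<in> tedges l"
  using level_past[OF assms(1,2)] mem_tedges_iff_past[OF assms(1,3)] edges_dom_faces[OF assms(3)] assms(4)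
  by (force simp: crosses_def)

lemma extend_to_boundary:
  assumes "(t, x) \<in> S" "h (t - 1, x) < s" "s \<le> h (t + 1, x)"
  shows "\<exists>ds. ds \<noteq> [] \<and> set ds \<subseteq> {-1, 1} \<and> (\<forall>i<length ds. vtx ((t, x), ds) i \<in> S) \<and>
    vtx ((t, x), ds) (length ds) \<in> bdry S \<and>
    (\<forall>i<length ds. crosses s (tedge ((t, x), ds) (Suc i)))"
  using assms
proof (induction "nat (b - c - 2 * x)" arbitrary: t x rule: less_induct)
  case less
  have "\<exists>\<delta>\<in>{-1, 1}. crosses s (mk_edge (t, x) (t + \<delta>, x + 1))"
    using less.prems by (auto simp: crosses_def mk_edge_def west_def east_def)
  then obtain \<delta> where \<delta>: "\<delta> \<in> {-1, 1}" "crosses s (mk_edge (t, x) (t + \<delta>, x + 1))" by blast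
  show ?case
  proof (cases "(t + \<delta>, x + 1) \<in> S")
    case True
    let ?l = "((t + \<delta>, x + 1))"
    have "nat (b - c - 2 * (x + 1)) < nat (b - c - 2 * x)"
      using less.prems(1) True by (auto simp: mem_S)
    moreover have "h (t + \<delta> - 1, x + 1) < s \<and> s \<le> h (t + \<delta> + 1, x + 1)"
    proof -
      have n: "(t + \<delta> - 1, x + 1) \<in> faces" "(t + \<delta> + 1, x + 1) \<in> faces"
        "(t + \<delta>, x) \<in> faces"
        using True by (auto simp: mem_S mem_faces)
      have "h (t + \<delta> - 1, x + 1) \<le> h (t + \<delta>, x)" "h (t + \<delta>, x) \<le> h (t + \<delta> + 1, x + 1)"
        using h_mono[OF n(1,3)] h_mono[OF n(3,2)] by (auto simp: cone_le_def)
      then show ?thesis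
        using \<delta> by (auto simp: crosses_def mk_edge_def west_def east_def)
    qed
    ultimately obtain ds where ds: "ds \<noteq> []" "set ds \<subseteq> {-1, 1}"
      "\<And>i. i < length ds \<Longrightarrow> vtx (?l, ds) i \<in> S" "vtx (?l, ds) (length ds) \<in> bdry S"
      "\<And>i. i < length ds \<Longrightarrow> crosses s (tedge (?l, ds) (Suc i))"
      using less.hyps[of "x + 1" "t + \<delta>"] True by blast
    have "vtx ((t, x), \<delta> # ds) i \<in> S" if "i < Suc (length ds)" for i
      using that ds(3) less.prems(1) by (cases i) (auto simp: vtx_0 vtx_Cons)
    moreover have "crosses s (tedge ((t, x), \<delta> # ds) (Suc i))" if "i < Suc (length ds)" for i
      using that ds(5) \<delta>(2) by (cases i) (auto simp: tedge_def vtx_0 vtx_Cons)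
    ultimately show ?thesis
      using ds(1,2,4) \<delta>(1) by (intro exI[of _ "\<delta> # ds"]) (auto simp: vtx_Cons)
  next
    case False
    then have "(t + \<delta>, x + 1) \<in> bdry S"
      using \<delta>(1) by (intro in_bdryI[OF less.prems(1)]) (auto simp: nbrs_def)
    then show ?thesis
      using \<delta> less.prems(1) by (intro exI[of _ "[\<delta>]"]) (auto simp: vtx_0 vtx_Cons tedge_def)
  qed
qed

lemma start_to_Ctr:
  assumes y: "(t, x) \<in> S" and \<delta>: "\<delta> \<in> {-1, 1}" and y0: "(t - \<delta>, x - 1) \<in> bdry S"
    and cr: "crosses s (mk_edge (t - \<delta>, x - 1) (t, x))"
  shows "\<exists>l\<in>Ctr S. \<forall>e\<in>tedges l. crosses s e"
proof -
  have n: "(t - 1, x) \<in> faces" "(t + 1, x) \<in> faces" "(t, x - 1) \<in> faces"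
    using y by (auto simp: mem_S mem_faces)
  have "h (t - 1, x) \<le> h (t, x - 1)" "h (t, x - 1) \<le> h (t + 1, x)"
    using h_mono[OF n(1,3)] h_mono[OF n(3,2)] by (auto simp: cone_le_def)
  then have "h (t - 1, x) < s" "s \<le> h (t + 1, x)"
    using cr \<delta> by (auto simp: crosses_def mk_edge_def west_def east_def)
  from extend_to_boundary[OF y this] obtain ds where ds: "ds \<noteq> []" "set ds \<subseteq> {-1, 1}"
    "\<And>i. i < length ds \<Longrightarrow> vtx ((t, x), ds) i \<in> S" "vtx ((t, x), ds) (length ds) \<in> bdry S"
    "\<And>i. i < length ds \<Longrightarrow> crosses s (tedge ((t, x), ds) (Suc i))"
    by blast
  define l where "l = ((t - \<delta>, x - 1), \<delta> # ds)"
  have len: "tlen l = Suc (length ds)" by (simp add: l_def tlen_def)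
  have vS: "vtx l (Suc i) = vtx ((t, x), ds) i" for i by (simp add: l_def vtx_Cons)
  have v0: "vtx l 0 = (t - \<delta>, x - 1)" by (simp add: l_def vtx_0)
  have "even (t - \<delta> + (x - 1))" using y \<delta> by (auto simp: mem_S)
  then have tr: "is_trace l" using ds(2) \<delta> by (auto simp: l_def is_trace_def lat_def)
  have cross: "crosses s (tedge l (Suc i))" if "i < tlen l" for i
    using that ds(5) cr len by (cases i) (simp_all add: tedge_def vS v0, simp add: vtx_0)
  have inS: "vtx l (Suc i) \<in> S" if "Suc i < tlen l" for i
    using that ds(3) len by (simp add: vS)
  have last: "vtx l (tlen l) \<in> bdry S" using ds(4) len by (simp add: vS)
  have "tedge l i \<in> edges_dom S" if "1 \<le> i" "i \<le> tlen l" for i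
  proof (rule edges_domI)
    show "is_edge (tedge l i)"
      using that mem_tedges_iff[OF tr, of "tedge l i"] by (auto simp: tedges_def)
    have "vtx l (i - 1) \<in> S \<or> vtx l i \<in> S"
    proof (cases "i = 1")
      case True
      then show ?thesis using inS[of 0] ds(1) len by simp
    next
      case False
      then show ?thesis using inS[of "i - 2"] that by (simp add: numeral_2_eq_2 Suc_diff_Suc)
    qed
    then show "fst (tedge l i) \<in> S \<or> snd (tedge l i) \<in> S" by (auto simp: tedge_def mk_edge_def)
  qed
  moreover have "vtx l i \<in> S" if "1 \<le> i" "i < tlen l" for i
    using that inS[of "i - 1"] by simp
  ultimately have "l \<in> Ctr S"
    using tr last y0 v0 by (auto simp: Ctr_def in_closure_def bdry_def)
  moreover have "crosses s e" if e: "e \<in> tedges l" for e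
  proof -
    obtain i where i: "1 \<le> i" "i \<le> tlen l" "e = tedge l i" using e by (auto simp: tedges_def)
    then show ?thesis using cross[of "i - 1"] by simp
  qed
  ultimately show ?thesis by blast
qed

text \<open>Walking from the western to the eastern corner face along the part of the boundary where
  traces enter, the potential must pass the level \<open>s\<close>.\<close>

lemma level_trace_exists:
  assumes "e0 \<in> edges_dom S" "crosses s e0"
  shows "\<exists>l\<in>Ctr S. \<forall>e\<in>tedges l. crosses s e"
proof -
  obtain \<alpha> \<beta> \<gamma> \<delta> where abcd: "a = 2 * \<alpha>" "b = 2 * \<beta>" "c = 2 * \<gamma>" "d = 2 * \<delta>"
    using ev by (elim evenE)
  have le: "\<alpha> \<le> \<beta>" "\<gamma> \<le> \<delta>" using ab cd abcd by auto
  let ?w = "(\<alpha> + \<gamma> - 1, \<alpha> - \<gamma>)" and ?e = "(\<beta> + \<delta> + 1, \<beta> - \<delta>)" and ?m = "(\<alpha> + \<delta>, \<alpha> - \<delta> - 1)"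
  have fc: "?w \<in> faces" "?e \<in> faces" unfolding mem_faces using le abcd by auto
  note F = edges_dom_faces[OF assms(1)]
  have "?w \<sqsubseteq> west e0" "east e0 \<sqsubseteq> ?e"
    using F abcd unfolding faces_def cone_le_def by auto
  then have "h ?w \<le> h (west e0)" "h (east e0) \<le> h ?e" using h_mono F fc by blast+
  then have s: "h ?w < s" "s \<le> h ?e" using assms(2) by (auto simp: crosses_def)
  show ?thesis
  proof (cases "s \<le> h ?m")
    case True
    define g where "g k = h (\<alpha> + \<gamma> - 1 + int k, \<alpha> - \<gamma> - int k)" for k
    have "g 0 < s" "s \<le> g (nat (\<delta> - \<gamma> + 1))"
      using s(1) True le by (simp_all add: g_def algebra_simps)
    then obtain k where k: "k < nat (\<delta> - \<gamma> + 1)" "g k < s" "s \<le> g (Suc k)"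
      using discrete_ivt by blast
    let ?t = "\<alpha> + \<gamma> + int k" and ?x = "\<alpha> - \<gamma> - int k"
    have y: "(?t, ?x) \<in> S" unfolding mem_S using k(1) le abcd by auto
    have "(?t - 1, ?x - 1) \<in> bdry S"
      by (rule in_bdryI[OF y]) (use abcd in \<open>auto simp: nbrs_def rect_domain_def\<close>)
    moreover have "crosses s (mk_edge (?t - 1, ?x - 1) (?t, ?x))"
      using k by (simp add: crosses_def mk_edge_def west_def east_def g_def algebra_simps)
    ultimately show ?thesis using start_to_Ctr[OF y, of 1] by simp
  next
    case False
    define g where "g k = h (\<alpha> + \<delta> + int k, \<alpha> - \<delta> - 1 + int k)" for k
    have "g 0 < s" "s \<le> g (nat (\<beta> - \<alpha> + 1))"
      using s(2) False le by (simp_all add: g_def algebra_simps)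
    then obtain k where k: "k < nat (\<beta> - \<alpha> + 1)" "g k < s" "s \<le> g (Suc k)"
      using discrete_ivt by blast
    let ?t = "\<alpha> + \<delta> + int k" and ?x = "\<alpha> - \<delta> + int k"
    have y: "(?t, ?x) \<in> S" unfolding mem_S using k(1) le abcd by auto
    have "(?t + 1, ?x - 1) \<in> bdry S"
      by (rule in_bdryI[OF y]) (use abcd in \<open>auto simp: nbrs_def rect_domain_def\<close>)
    moreover have "crosses s (mk_edge (?t + 1, ?x - 1) (?t, ?x))"
      using k by (simp add: crosses_def mk_edge_def west_def east_def g_def algebra_simps)
    ultimately show ?thesis using start_to_Ctr[OF y, of "-1"] by simp
  qed
qed

definition levels :: "edge set \<Rightarrow> real set" where
  "levels E = {s. \<forall>e\<in>E. crosses s e}"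

lemma levels_measurable:
  assumes "finite E" "E \<noteq> {}"
  shows "levels E \<in> lmeasurable"
proof -
  obtain e where e: "e \<in> E" using assms(2) by blast
  have eq: "levels E = (\<Inter>e\<in>E. {h (west e)<..h (east e)})"
    by (auto simp: levels_def crosses_def)
  have "levels E \<in> sets lebesgue"
    unfolding eq using assms by (intro sets.finite_INT) auto
  moreover have "levels E \<subseteq> {h (west e)..h (east e)}"
    using e by (auto simp: levels_def crosses_def)
  then have "bounded (levels E)" using bounded_closed_interval bounded_subset by blast
  ultimately show ?thesis by (intro bounded_set_imp_lmeasurable)
qed

lemma levels_tedges_measurable: "is_trace l \<Longrightarrow> levels (tedges l) \<in> lmeasurable"
  by (simp add: levels_measurable finite_tedges tedges_nonempty)

lemma levels_unique:
  assumes "l \<in> Ctr S" "l' \<in> Ctr S" "s \<in> levels (tedges l)" "s \<in> levels (tedges l')"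
  shows "l = l'"
  using past_inj[OF assms(1,2)] level_past assms by (simp add: levels_def)

lemma levels_decomp:
  assumes "E \<subseteq> edges_dom S" "E \<noteq> {}"
  shows "levels E = (\<Union>l\<in>{l\<in>Ctr S. E \<subseteq> tedges l}. levels (tedges l))"
proof
  show "levels E \<subseteq> (\<Union>l\<in>{l\<in>Ctr S. E \<subseteq> tedges l}. levels (tedges l))"
  proof
    fix s assume s: "s \<in> levels E"
    obtain e where "e \<in> E" using assms(2) by blast
    then obtain l where l: "l \<in> Ctr S" "\<forall>e\<in>tedges l. crosses s e"
      using level_trace_exists[of e s] s assms(1) unfolding levels_def by blast
    then have "E \<subseteq> tedges l" using crosses_imp_mem[OF l] s assms(1) by (auto simp: levels_def)
    then show "s \<in> (\<Union>l\<in>{l\<in>Ctr S. E \<subseteq> tedges l}. levels (tedges l))"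
      using l unfolding levels_def by blast
  qed
qed (auto simp: levels_def)

lemma measure_levels_decomp:
  assumes "E \<subseteq> edges_dom S" "E \<noteq> {}"
  shows "measure lebesgue (levels E) =
    (\<Sum>l\<in>Ctr S. measure lebesgue (levels (tedges l)) * (if E \<subseteq> tedges l then 1 else 0))"
proof -
  have "measure lebesgue (levels E) =
    (\<Sum>l\<in>{l\<in>Ctr S. E \<subseteq> tedges l}. measure lebesgue (levels (tedges l)))"
    unfolding levels_decomp[OF assms]
  proof (rule measure_finite_Union)
    show "disjoint_family_on (\<lambda>l. levels (tedges l)) {l \<in> Ctr S. E \<subseteq> tedges l}"
      using levels_unique by (auto simp: disjoint_family_on_def)
    have "levels (tedges l) \<in> lmeasurable" if "l \<in> Ctr S" for l
      using levels_tedges_measurable Ctr_trace[OF that] by blast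
    note meas = fmeasurableD[OF this] fmeasurableD2[OF this]
    show "(\<lambda>l. levels (tedges l)) ` {l \<in> Ctr S. E \<subseteq> tedges l} \<subseteq> sets lebesgue"
      and "\<And>l. l \<in> {l \<in> Ctr S. E \<subseteq> tedges l} \<Longrightarrow> emeasure lebesgue (levels (tedges l)) \<noteq> \<infinity>"
      using meas by (blast, simp)
  qed (simp add: finite_Ctr)
  also have "\<dots> = (\<Sum>l\<in>Ctr S. measure lebesgue (levels (tedges l)) * (if E \<subseteq> tedges l then 1 else 0))"
    using finite_Ctr by (intro sum.mono_neutral_cong_left) auto
  finally show ?thesis .
qed

text \<open>Adding the potential on its western side turns the position on an edge into a level;
  associated positions are those at the same level.\<close>

lemma assoc_iff_level:
  assumes y: "y \<in> S" and f1: "f1 = e_sw y \<or> f1 = e_se y" and f2: "f2 = e_nw y \<or> f2 = e_ne y"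
  shows "assoc \<eta> y f1 p1 f2 p2 \<longleftrightarrow>
    0 < p1 \<and> p1 \<le> \<eta> f1 \<and> 0 < p2 \<and> p2 \<le> \<eta> f2 \<and> p1 + h (west f1) = p2 + h (west f2)"
proof -
  obtain t x where yt: "y = (t, x)" by fastforce
  have ed: "e_ne y \<in> edges_dom S" "e_se y \<in> edges_dom S" "e_sw y \<in> edges_dom S" "e_nw y \<in> edges_dom S"
    using y by (auto simp: edges_dom_def)
  have ne: "e_sw y \<noteq> e_se y" "e_se y \<noteq> e_sw y" "e_nw y \<noteq> e_ne y" "e_ne y \<noteq> e_nw y"
    by (auto simp: yt e_sw_def e_se_def e_nw_def e_ne_def)
  have eta: "\<eta> (e_ne y) = h (t + 1, x) - h (t, x + 1)" "\<eta> (e_se y) = h (t + 1, x) - h (t, x - 1)"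
    "\<eta> (e_sw y) = h (t, x - 1) - h (t - 1, x)" "\<eta> (e_nw y) = h (t, x + 1) - h (t - 1, x)"
    using ed pot by (simp_all add: yt west_east_simps)
  have w: "west (e_ne y) = (t, x + 1)" "west (e_se y) = (t, x - 1)"
    "west (e_sw y) = (t - 1, x)" "west (e_nw y) = (t - 1, x)"
    by (simp_all add: yt west_east_simps)
  note nn = ed[THEN nonneg, unfolded eta]
  from f1 f2 show ?thesis
    by (elim disjE) (use nn in \<open>auto simp: assoc_def birth_def ne eta w min_def\<close>)
qed

lemma weight_eq_levels:
  assumes tr: "is_trace l" and cl: "in_closure S l"
  shows "weight \<eta> l = measure lebesgue (levels (tedges l))"
proof -
  let ?c = "h (west (tedge l 1))"
  have E: "tedge l i \<in> edges_dom S" if "1 \<le> i" "i \<le> tlen l" for i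
    using cl that by (auto simp: in_closure_def)
  have as: "assoc \<eta> (vtx l (i - 1)) (tedge l (i - 1)) p1 (tedge l i) p2 \<longleftrightarrow>
      0 < p1 \<and> p1 \<le> \<eta> (tedge l (i - 1)) \<and> 0 < p2 \<and> p2 \<le> \<eta> (tedge l i) \<and>
      p1 + h (west (tedge l (i - 1))) = p2 + h (west (tedge l i))"
    if "2 \<le> i" "i \<le> tlen l" for i p1 p2
  proof -
    obtain k where k: "i = Suc (Suc k)" using \<open>2 \<le> i\<close> by (metis Suc_le_D numeral_2_eq_2 Suc_le_mono)
    have "vtx l (Suc k) \<in> S" using cl that k by (auto simp: in_closure_def)
    then show ?thesis
      using assoc_iff_level tedge_lower[OF tr, of k] tedge_upper[OF tr, of "Suc k"] that k by simp
  qed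
  define P where "P = {p1. 0 < p1 \<and> p1 \<le> \<eta> (tedge l 1) \<and>
          (\<exists>p :: nat \<Rightarrow> real. p 1 = p1 \<and>
             (\<forall>i. 2 \<le> i \<and> i \<le> tlen l \<longrightarrow> 0 < p i \<and> p i \<le> \<eta> (tedge l i)) \<and>
             (\<forall>i. 2 \<le> i \<and> i \<le> tlen l \<longrightarrow>
                assoc \<eta> (vtx l (i - 1)) (tedge l (i - 1)) (p (i - 1)) (tedge l i) (p i)))}"
  have lev: "s \<in> levels (tedges l) \<longleftrightarrow> (\<forall>i. 1 \<le> i \<and> i \<le> tlen l \<longrightarrow> crosses s (tedge l i))" for s
    by (auto simp: levels_def tedges_def)
  have "p1 \<in> P \<longleftrightarrow> ?c + p1 \<in> levels (tedges l)" for p1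
  proof
    assume "p1 \<in> P"
    then obtain p where p: "0 < p1" "p1 \<le> \<eta> (tedge l 1)" "p 1 = p1"
      "\<And>i. 2 \<le> i \<Longrightarrow> i \<le> tlen l \<Longrightarrow> 0 < p i \<and> p i \<le> \<eta> (tedge l i)"
      "\<And>i. 2 \<le> i \<Longrightarrow> i \<le> tlen l \<Longrightarrow>
         assoc \<eta> (vtx l (i - 1)) (tedge l (i - 1)) (p (i - 1)) (tedge l i) (p i)"
      unfolding P_def by blast
    have same: "p (Suc k) + h (west (tedge l (Suc k))) = ?c + p1" if "Suc k \<le> tlen l" for k
      using that
    proof (induction k)
      case 0
      then show ?case using p(3) by simp
    next
      case (Suc k)
      then show ?case using p(5)[of "Suc (Suc k)"] as[of "Suc (Suc k)"] by simp
    qed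
    have "crosses (?c + p1) (tedge l i)" if i: "1 \<le> i" "i \<le> tlen l" for i
    proof -
      have "0 < p i \<and> p i \<le> \<eta> (tedge l i)"
        using p(1-3) p(4)[of i] i by (cases "i = 1") auto
      moreover have "p i + h (west (tedge l i)) = ?c + p1" using same[of "i - 1"] i by simp
      ultimately show ?thesis using pot[OF E[OF i]] by (simp add: crosses_def)
    qed
    then show "?c + p1 \<in> levels (tedges l)" by (simp add: lev)
  next
    assume "?c + p1 \<in> levels (tedges l)"
    then have cr: "crosses (?c + p1) (tedge l i)" if "1 \<le> i" "i \<le> tlen l" for i
      using that by (simp add: lev)
    define p where "p i = ?c + p1 - h (west (tedge l i))" for i
    have pp: "0 < p i \<and> p i \<le> \<eta> (tedge l i)" if "1 \<le> i" "i \<le> tlen l" for i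
      using cr[OF that] pot[OF E[OF that]] by (auto simp: p_def crosses_def)
    have "p 1 = p1" by (simp add: p_def)
    moreover have "0 < p1" "p1 \<le> \<eta> (tedge l 1)" using pp[of 1] tlen_pos[OF tr] by (auto simp: p_def)
    moreover have "assoc \<eta> (vtx l (i - 1)) (tedge l (i - 1)) (p (i - 1)) (tedge l i) (p i)"
      if "2 \<le> i" "i \<le> tlen l" for i
      unfolding as[OF that] using pp[of i] pp[of "i - 1"] that by (simp add: p_def)
    ultimately show "p1 \<in> P" using pp unfolding P_def by (auto intro!: exI[of _ p])
  qed
  then have "levels (tedges l) = (\<lambda>p. ?c + p) ` P"
    by (auto simp: image_iff intro!: bexI[of _ "_ - ?c"])
  then show ?thesis by (simp add: weight_def P_def measure_translation)
qed

end

subsection \<open>The order on traces and the decompositions\<close>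

lemma sum_nth_distinct:
  "distinct xs \<Longrightarrow> (\<Sum>j<length xs. f (xs ! j)) = sum f (set xs)"
  by (rule sum.reindex_bij_betw) (rule bij_betw_nth[OF _ refl refl])

context rect
begin

definition past_card :: "trace \<Rightarrow> nat" where "past_card l = card (past l \<inter> faces)"

lemma past_card_mono: "l \<in> Ctr S \<Longrightarrow> l' \<in> Ctr S \<Longrightarrow> tsucceq l' l \<Longrightarrow> past_card l \<le> past_card l'"
  unfolding past_card_def using finite_faces tsucceq_iff_past by (intro card_mono) auto

lemma tsucceq_antisym:
  "l \<in> Ctr S \<Longrightarrow> l' \<in> Ctr S \<Longrightarrow> tsucceq l l' \<Longrightarrow> tsucceq l' l \<Longrightarrow> l = l'"
  using past_inj[of l l'] tsucceq_iff_past[of l l'] tsucceq_iff_past[of l' l] by blast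

lemma tsucceq_trans:
  "l \<in> Ctr S \<Longrightarrow> l' \<in> Ctr S \<Longrightarrow> l'' \<in> Ctr S \<Longrightarrow> tsucceq l l' \<Longrightarrow> tsucceq l' l'' \<Longrightarrow> tsucceq l l''"
  using tsucceq_iff_past[of l l'] tsucceq_iff_past[of l' l''] tsucceq_iff_past[of l l''] by blast

lemma past_card_eq_imp_eq:
  assumes "l \<in> Ctr S" "l' \<in> Ctr S" "tsucceq l' l" "past_card l = past_card l'"
  shows "l = l'"
proof -
  have "past l \<inter> faces = past l' \<inter> faces"
    using assms finite_faces by (intro card_subset_eq) (auto simp: past_card_def tsucceq_iff_past)
  then show ?thesis using past_inj assms by blast
qed

lemma past_card_strict_mono: "l \<in> Ctr S \<Longrightarrow> l' \<in> Ctr S \<Longrightarrow> tprec l l' \<Longrightarrow> past_card l < past_card l'"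
  using past_card_mono past_card_eq_imp_eq by (fastforce simp: tprec_def tsucc_def order.order_iff_strict)

lemma prec_chain_sorted:
  assumes "set ls \<subseteq> Ctr S" "prec_chain ls"
  shows "sorted_wrt (<) (map past_card ls)"
proof -
  have "past_card (ls ! i) < past_card (ls ! j)" if "i < j" "j < length ls" for i j
    using assms that by (intro past_card_strict_mono) (auto simp: prec_chain_def)
  then show ?thesis by (auto simp: sorted_wrt_iff_nth_less)
qed

lemma prec_chain_distinct:
  assumes "set ls \<subseteq> Ctr S" "prec_chain ls"
  shows "distinct ls" "inj_on past_card (set ls)"
  using prec_chain_sorted[OF assms] by (auto simp: strict_sorted_iff distinct_map)

lemma prec_chain_unique:
  assumes "set ls \<subseteq> Ctr S" "prec_chain ls" "prec_chain ls'" "set ls' = set ls"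
  shows "ls' = ls"
proof -
  have "map past_card ls' = map past_card ls"
    using prec_chain_sorted assms by (intro strict_sorted_equal) auto
  then show ?thesis
    using prec_chain_distinct[OF assms(1,2)] assms(4) by (metis map_inj_on sup.idem)
qed

lemma prec_chain_exists:
  assumes "P \<subseteq> Ctr S" and tot: "\<And>l l'. l \<in> P \<Longrightarrow> l' \<in> P \<Longrightarrow> tsucceq l l' \<or> tsucceq l' l"
  shows "\<exists>ls. set ls = P \<and> prec_chain ls"
proof -
  have fin: "finite P" using assms(1) finite_Ctr finite_subset by blast
  have inj: "inj_on past_card P"
  proof (rule inj_onI)
    fix l l' assume "l \<in> P" "l' \<in> P" "past_card l = past_card l'"
    then show "l = l'" using tot[of l l'] past_card_eq_imp_eq[of l l'] past_card_eq_imp_eq[of l' l] assms(1) by auto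
  qed
  define zs where "zs = sorted_list_of_set (past_card ` P)"
  have zs: "set zs = past_card ` P" "sorted_wrt (<) zs" using fin by (auto simp: zs_def)
  define ls where "ls = map (inv_into P past_card) zs"
  have set: "set ls = P" using inj zs by (simp add: ls_def)
  have "tprec (ls ! i) (ls ! j)" if ij: "i < j" "j < length ls" for i j
  proof -
    have "zs ! k = past_card (ls ! k)" if "k < length ls" for k
      using that nth_mem[of k zs] zs(1) by (simp add: ls_def f_inv_into_f)
    then have lt: "past_card (ls ! i) < past_card (ls ! j)"
      using zs(2) ij by (auto simp: sorted_wrt_iff_nth_less ls_def)
    have P: "ls ! i \<in> P" "ls ! j \<in> P" using ij set by auto
    have "\<not> tsucceq (ls ! i) (ls ! j)" using past_card_mono[of "ls ! j" "ls ! i"] lt P assms(1) by auto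
    then show ?thesis using tot[OF P] lt by (auto simp: tprec_def tsucc_def)
  qed
  then show ?thesis using set by (auto simp: prec_chain_def)
qed

lemma potential_exists:
  assumes "flow_field S \<eta>"
  shows "\<exists>h. rect_potential a b c d h \<eta>"
proof -
  obtain \<alpha> \<beta> \<gamma> \<delta> where abcd: "a = 2 * \<alpha>" "b = 2 * \<beta>" "c = 2 * \<gamma>" "d = 2 * \<delta>"
    using ev by (elim evenE)
  define P where "P i j = (\<alpha> + \<gamma> + int i + int j, \<alpha> - \<gamma> + int i - int j)" for i j :: nat
  define G where "G i j = (\<Sum>k<i. \<eta> (e_nw (P k 0))) + (\<Sum>k<j. \<eta> (e_sw (P i k)))" for i j :: nat
  have P_S: "P i j \<in> S" if "int i \<le> \<beta> - \<alpha>" "int j \<le> \<delta> - \<gamma>" for i j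
    using that abcd by (auto simp: P_def rect_domain_def)
  have south: "G i (Suc j) - G i j = \<eta> (e_sw (P i j))" for i j
    by (simp add: G_def)
  have north: "G (Suc i) j - G i j = \<eta> (e_nw (P i j))" if i: "int i \<le> \<beta> - \<alpha>" and "int j \<le> \<delta> - \<gamma> + 1" for i j
    using that(2)
  proof (induction j)
    case 0
    then show ?case by (simp add: G_def)
  next
    case (Suc j)
    have "e_sw (P (Suc i) j) = e_ne (P i j)" "e_nw (P i (Suc j)) = e_se (P i j)"
      by (auto simp: P_def e_sw_def e_ne_def e_nw_def e_se_def)
    moreover have "\<eta> (e_nw (P i j)) + \<eta> (e_ne (P i j)) = \<eta> (e_sw (P i j)) + \<eta> (e_se (P i j))"
      using assms P_S[OF i, of j] Suc.prems by (auto simp: flow_field_def)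
    ultimately show ?case using Suc south[of i j] south[of "Suc i" j] by simp
  qed
  define h where "h f = G (nat ((fst f + snd f + 1 - a) div 2)) (nat ((fst f - snd f + 1 - c) div 2))" for f
  have h: "h (\<alpha> + \<gamma> - 1 + int i + int j, \<alpha> - \<gamma> + int i - int j) = G i j" for i j
  proof -
    have "(\<alpha> + \<gamma> - 1 + int i + int j) + (\<alpha> - \<gamma> + int i - int j) + 1 - a = 2 * int i"
      "(\<alpha> + \<gamma> - 1 + int i + int j) - (\<alpha> - \<gamma> + int i - int j) + 1 - c = 2 * int j"
      using abcd by auto
    then show ?thesis by (simp add: h_def)
  qed
  have hsw: "h (east (e_sw (P i j))) - h (west (e_sw (P i j))) = \<eta> (e_sw (P i j))" for i j
    using south[of i j] h[of i j] h[of i "Suc j"] by (simp add: P_def west_east_simps algebra_simps)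
  have hnw: "h (east (e_nw (P i j))) - h (west (e_nw (P i j))) = \<eta> (e_nw (P i j))"
    if "int i \<le> \<beta> - \<alpha>" "int j \<le> \<delta> - \<gamma> + 1" for i j
    using north[OF that] h[of i j] h[of "Suc i" j] by (simp add: P_def west_east_simps algebra_simps)
  have "\<eta> e = h (east e) - h (west e)" if e: "e \<in> edges_dom S" for e
  proof -
    obtain y where y: "y \<in> S" "e = e_ne y \<or> e = e_se y \<or> e = e_sw y \<or> e = e_nw y"
      using e by (rule edges_dom_cases)
    obtain t x where tx: "y = (t, x)" by fastforce
    have S: "even (t + x)" "a \<le> t + x" "t + x \<le> b" "c \<le> t - x" "t - x \<le> d"
      using y(1) by (auto simp: tx mem_S)
    have "even (t - x)" using S(1) by simp
    then obtain u v where uv: "t + x = 2 * u" "t - x = 2 * v" using S(1) by (metis evenE)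
    define i j where "i = nat (u - \<alpha>)" "j = nat (v - \<gamma>)"
    have ij: "int i = u - \<alpha>" "int j = v - \<gamma>" using S uv abcd by (auto simp: i_j_def)
    have yP: "y = P i j" using ij uv by (auto simp: tx P_def)
    have le: "int i \<le> \<beta> - \<alpha>" "int j \<le> \<delta> - \<gamma>" using ij S uv abcd by auto
    have "e_ne y = e_sw (P (Suc i) j)" "e_se y = e_nw (P i (Suc j))"
      by (auto simp: yP P_def e_sw_def e_ne_def e_nw_def e_se_def)
    then show ?thesis
      using y(2) hsw[of i j] hsw[of "Suc i" j] hnw[of i j] hnw[of i "Suc j"] le by (auto simp: yP)
  qed
  then have "rect_potential a b c d h \<eta>"
    using assms by unfold_locales (auto simp: flow_field_def)
  then show ?thesis by blast
qed

end

context rect_potential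
begin

lemma weight_Ctr: "l \<in> Ctr S \<Longrightarrow> weight \<eta> l = measure lebesgue (levels (tedges l))"
  using weight_eq_levels Ctr_trace Ctr_closure by blast

lemma measure_levels:
  "E \<subseteq> edges_dom S \<Longrightarrow> E \<noteq> {} \<Longrightarrow>
    measure lebesgue (levels E) = (\<Sum>l\<in>Ctr S. weight \<eta> l * (if E \<subseteq> tedges l then 1 else 0))"
  by (simp add: measure_levels_decomp weight_Ctr)

lemma flow_field: "flow_field S \<eta>"
proof -
  have "\<eta> (e_nw y) + \<eta> (e_ne y) = \<eta> (e_sw y) + \<eta> (e_se y)" if "y \<in> S" for y
    using mem_S_edges_dom[OF that] by (cases y) (simp add: pot west_east_simps)
  then show ?thesis by (simp add: flow_field_def nonneg)
qed

lemma eta_decomp: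
  assumes "e \<in> edges_dom S"
  shows "\<eta> e = (\<Sum>l\<in>Ctr S. weight \<eta> l * (if e \<in> tedges l then 1 else 0))"
proof -
  have "levels {e} = {h (west e)<..h (east e)}" by (auto simp: levels_def crosses_def)
  then have "measure lebesgue (levels {e}) = \<eta> e"
    using h_west_le_east[OF assms] pot[OF assms] by simp
  then show ?thesis using measure_levels[of "{e}"] assms by simp
qed

lemma birth_decomp:
  assumes "y \<in> S"
  shows "birth \<eta> y = (\<Sum>l\<in>Ctr S. weight \<eta> l * indicator (left_corners l) y)"
proof -
  obtain t x where y: "y = (t, x)" by fastforce
  note ed = mem_S_edges_dom[OF assms]
  have "levels {e_ne y, e_se y} = {max (h (t, x + 1)) (h (t, x - 1))<..h (t + 1, x)}"
    by (auto simp: levels_def crosses_def y west_east_simps)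
  moreover have "h (t, x + 1) \<le> h (t + 1, x)" "h (t, x - 1) \<le> h (t + 1, x)"
    using h_west_le_east[OF ed(1)] h_west_le_east[OF ed(2)] by (auto simp: y west_east_simps)
  ultimately have "measure lebesgue (levels {e_ne y, e_se y}) = birth \<eta> y"
    using pot[OF ed(1)] pot[OF ed(2)] by (auto simp: birth_def y west_east_simps max_def min_def)
  then have "birth \<eta> y = (\<Sum>l\<in>Ctr S. weight \<eta> l * (if {e_ne y, e_se y} \<subseteq> tedges l then 1 else 0))"
    using measure_levels[of "{e_ne y, e_se y}"] ed by simp
  also have "\<dots> = (\<Sum>l\<in>Ctr S. weight \<eta> l * indicator (left_corners l) y)"
  proof (rule sum.cong)
    fix l assume "l \<in> Ctr S"
    then have "is_trace l" by (rule Ctr_trace)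
    then have "{e_ne y, e_se y} \<subseteq> tedges l \<longleftrightarrow> y \<in> left_corners l"
      by (auto simp: mem_tedges_iff left_corners_def y e_ne_def e_se_def is_edge_def)
    then show "weight \<eta> l * (if {e_ne y, e_se y} \<subseteq> tedges l then 1 else 0) =
        weight \<eta> l * indicator (left_corners l) y"
      by (simp add: indicator_def)
  qed simp
  finally show ?thesis .
qed

lemma zeta_plus_decomp:
  assumes "y \<in> zp_dom S"
  shows "zeta_plus \<eta> y = (\<Sum>l\<in>Ctr S. weight \<eta> l * zp_tr S l y)"
proof -
  have y: "y \<in> S" using assms by (auto simp: zp_dom_def)
  have "zeta_plus \<eta> y = (\<Sum>l\<in>Ctr S. weight \<eta> l * (if e_sw y \<in> tedges l then 1 else 0))"
    unfolding zeta_plus_def using mem_S_edges_dom[OF y] by (intro eta_decomp)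
  also have "\<dots> = (\<Sum>l\<in>Ctr S. weight \<eta> l * zp_tr S l y)"
    using assms
    by (intro sum.cong)
      (auto simp: mem_tedges_iff[OF Ctr_trace] zp_tr_def zp_dom_def e_sw_def is_edge_def)
  finally show ?thesis .
qed

lemma zeta_minus_decomp:
  assumes "y \<in> zm_dom S"
  shows "zeta_minus \<eta> y = (\<Sum>l\<in>Ctr S. weight \<eta> l * zm_tr S l y)"
proof -
  have y: "y \<in> S" using assms by (auto simp: zm_dom_def)
  have "zeta_minus \<eta> y = (\<Sum>l\<in>Ctr S. weight \<eta> l * (if e_nw y \<in> tedges l then 1 else 0))"
    unfolding zeta_minus_def using mem_S_edges_dom[OF y] by (intro eta_decomp)
  also have "\<dots> = (\<Sum>l\<in>Ctr S. weight \<eta> l * zm_tr S l y)"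
    using assms
    by (intro sum.cong)
      (auto simp: mem_tedges_iff[OF Ctr_trace] zm_tr_def zm_dom_def e_nw_def is_edge_def)
  finally show ?thesis .
qed

lemma weight_decomp:
  assumes "is_trace l" "in_closure S l"
  shows "weight \<eta> l = (\<Sum>l'\<in>Ctr S. weight \<eta> l' * (if subtrace l l' then 1 else 0))"
proof -
  have "weight \<eta> l = (\<Sum>l'\<in>Ctr S. weight \<eta> l' * (if tedges l \<subseteq> tedges l' then 1 else 0))"
    unfolding weight_eq_levels[OF assms]
    using tedges_subset_edges_dom[OF assms(2)] tedges_nonempty[OF assms(1)] by (rule measure_levels)
  also have "\<dots> = (\<Sum>l'\<in>Ctr S. weight \<eta> l' * (if subtrace l l' then 1 else 0))"
    by (intro sum.cong refl) (simp add: subtrace_iff_tedges assms Ctr_trace)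
  finally show ?thesis .
qed

lemma weight_pos_level:
  assumes "l \<in> Ctr S" "weight \<eta> l > 0"
  obtains s where "s \<in> levels (tedges l)"
  using assms weight_Ctr[OF assms(1)] by (cases "levels (tedges l) = {}") auto

lemma weight_pos_comparable:
  assumes "l \<in> Ctr S" "weight \<eta> l > 0" "l' \<in> Ctr S" "weight \<eta> l' > 0"
  shows "tsucceq l l' \<or> tsucceq l' l"
proof -
  obtain s where s: "s \<in> levels (tedges l)" using weight_pos_level assms by blast
  obtain s' where s': "s' \<in> levels (tedges l')" using weight_pos_level assms by blast
  have "past l \<inter> faces = {f \<in> faces. h f < s}" "past l' \<inter> faces = {f \<in> faces. h f < s'}"
    using level_past[OF assms(1)] level_past[OF assms(3)] s s' by (auto simp: levels_def)
  then show ?thesis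
    using tsucceq_iff_past assms by (cases "s \<le> s'") auto
qed

end

context rect
begin

lemma chain_realisable:
  fixes ls :: "trace list" and ws :: "real list"
  assumes len: "length ws = length ls" and C: "set ls \<subseteq> Ctr S" and ch: "prec_chain ls"
    and pos: "\<forall>w\<in>set ws. w > 0"
  shows "\<exists>\<eta>. flow_field S \<eta> \<and> characterizes S \<eta> ls ws"
proof -
  let ?n = "length ls"
  define W where "W k = (\<Sum>i<k. ws ! i)" for k
  define h where "h f = (\<Sum>i<?n. if f \<in> past (ls ! i) then 0 else ws ! i)" for f
  define \<eta> where "\<eta> e = h (east e) - h (west e)" for e
  have w0: "0 < ws ! i" if "i < ?n" for i using pos that len by auto
  have lC: "ls ! i \<in> Ctr S" if "i < ?n" for i using C that by auto
  have mono: "h f \<le> h g" if "f \<sqsubseteq> g" for f g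
    unfolding h_def using past_down_closed[OF that] w0 by (intro sum_mono) (auto intro: less_imp_le)
  interpret rect_potential a b c d h \<eta>
    using mono west_le_east edges_dom_is_edge by unfold_locales (auto simp: \<eta>_def)
  have sub: "past (ls ! i) \<inter> faces \<subseteq> past (ls ! j)" if "i \<le> j" "j < ?n" for i j
  proof (cases "i = j")
    case False
    then have "tprec (ls ! i) (ls ! j)" using that ch by (simp add: prec_chain_def)
    then show ?thesis
      using tsucceq_imp_past_subset[of "ls ! j" "ls ! i"] lC that by (simp add: tprec_def tsucc_def)
  qed auto
  have lev: "s \<in> levels (tedges (ls ! j))" if j: "j < ?n" and s: "W j < s" "s \<le> W (Suc j)" for s j
  proof -
    have "crosses s e" if e: "e \<in> tedges (ls ! j)" for e
    proof -
      have tr: "is_trace (ls ! j)" using lC[OF j] by (rule Ctr_trace)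
      have F: "west e \<in> faces" "east e \<in> faces"
        using e Ctr_edges[OF lC[OF j]] edges_dom_faces by blast+
      have "west e \<in> past (ls ! i)" if "j \<le> i" "i < ?n" for i
        using sub[OF that] west_in_past[OF tr e] F by blast
      then have "h (west e) \<le> (\<Sum>i<?n. if i < j then ws ! i else 0)"
        unfolding h_def using w0 by (intro sum_mono) (auto simp: not_less intro: less_imp_le)
      also have "\<dots> = W j"
        unfolding W_def using j by (intro sum.mono_neutral_cong_right) auto
      finally have 1: "h (west e) \<le> W j" .
      have "east e \<notin> past (ls ! i)" if "i \<le> j" for i
        using sub[OF that j] east_notin_past[OF tr e] F by blast
      then have "(\<Sum>i<?n. if i < Suc j then ws ! i else 0) \<le> h (east e)"
        unfolding h_def using w0 by (intro sum_mono) (auto intro: less_imp_le)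
      moreover have "W (Suc j) = (\<Sum>i<?n. if i < Suc j then ws ! i else 0)"
        unfolding W_def using j by (intro sum.mono_neutral_cong_left) auto
      ultimately show ?thesis using 1 s by (simp add: crosses_def)
    qed
    then show ?thesis by (simp add: levels_def)
  qed
  have find: "\<exists>j<?n. W j < s \<and> s \<le> W (Suc j) \<and> ls ! j = l"
    if l: "l \<in> Ctr S" and s: "s \<in> levels (tedges l)" for l s
  proof -
    obtain e where e: "e \<in> tedges l" using tedges_nonempty[OF Ctr_trace[OF l]] by blast
    have "0 \<le> h (west e)"
      unfolding h_def using w0 by (intro sum_nonneg) (auto intro: less_imp_le)
    moreover have "h (east e) \<le> W ?n"
      unfolding h_def W_def using w0 by (intro sum_mono) (auto intro: less_imp_le)
    ultimately have "W 0 < s" "s \<le> W ?n"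
      using s e by (auto simp: levels_def crosses_def W_def)
    then obtain j where j: "j < ?n" "W j < s" "s \<le> W (Suc j)" using discrete_ivt by blast
    have "ls ! j = l" using levels_unique[OF lC[OF j(1)] l lev[OF j] s] .
    then show ?thesis using j by blast
  qed
  have dist: "distinct ls" using prec_chain_distinct[OF C ch] by simp
  have "weight \<eta> (ls ! j) = ws ! j" if j: "j < ?n" for j
  proof -
    have "levels (tedges (ls ! j)) = {W j<..W (Suc j)}"
      using find[OF lC[OF j]] lev[OF j] dist j by (fastforce simp: nth_eq_iff_index_eq)
    then show ?thesis using weight_Ctr[OF lC[OF j]] w0[OF j] by (simp add: W_def)
  qed
  moreover have "weight \<eta> l = 0" if l: "l \<in> Ctr S" "l \<notin> set ls" for l
  proof -
    have "levels (tedges l) = {}" using find[OF l(1)] l(2) by (metis all_not_in_conv nth_mem)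
    then show ?thesis using weight_Ctr[OF l(1)] by simp
  qed
  ultimately have "characterizes S \<eta> ls ws" by (simp add: characterizes_def)
  then show ?thesis using flow_field by blast
qed

lemma characterizes_determines_flow:
  assumes "flow_field S \<eta>" "flow_field S \<eta>'" "characterizes S \<eta> ls ws" "characterizes S \<eta>' ls ws"
    and "e \<in> edges_dom S"
  shows "\<eta>' e = \<eta> e"
proof -
  obtain h where "rect_potential a b c d h \<eta>" using potential_exists[OF assms(1)] by blast
  then interpret A: rect_potential a b c d h \<eta> .
  obtain h' where "rect_potential a b c d h' \<eta>'" using potential_exists[OF assms(2)] by blast
  then interpret B: rect_potential a b c d h' \<eta>' .
  have "weight \<eta>' l = weight \<eta> l" if "l \<in> Ctr S" for l
    using assms(3,4) that by (cases "l \<in> set ls") (auto simp: characterizes_def in_set_conv_nth)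
  then show ?thesis by (simp add: A.eta_decomp[OF assms(5)] B.eta_decomp[OF assms(5)])
qed

end

theorem mainTheorem9:
  fixes a b c d :: int and S :: "pt set"
  assumes "even a" "even b" "even c" "even d" "a \<le> b" "c \<le> d"
    and S_def: "S = rect_domain a b c d" and "S \<noteq> {}"
  shows
    "(\<forall>(ls :: trace list) (ws :: real list).
        length ws = length ls \<and> set ls \<subseteq> Ctr S \<and> prec_chain ls \<and> (\<forall>w\<in>set ws. w > 0) \<longrightarrow>
        (\<exists>\<eta>. flow_field S \<eta> \<and> characterizes S \<eta> ls ws \<and>
              (\<forall>\<eta>'. flow_field S \<eta>' \<and> characterizes S \<eta>' ls ws \<longrightarrow>
                     (\<forall>e\<in>edges_dom S. \<eta>' e = \<eta> e))))
     \<and>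
     (\<forall>\<eta>. flow_field S \<eta> \<longrightarrow>
        (\<forall>l\<in>{l\<in>Ctr S. weight \<eta> l > 0}. \<forall>l'\<in>{l\<in>Ctr S. weight \<eta> l > 0}.
            (tsucceq l l' \<or> tsucceq l' l) \<and>
            (tsucceq l l' \<and> tsucceq l' l \<longrightarrow> l = l') \<and>
            (\<forall>l''\<in>{l\<in>Ctr S. weight \<eta> l > 0}. tsucceq l l' \<and> tsucceq l' l'' \<longrightarrow> tsucceq l l'')) \<and>
        (\<exists>ls :: trace list.
            set ls = {l\<in>Ctr S. weight \<eta> l > 0} \<and> prec_chain ls \<and>
            (let ws = map (weight \<eta>) ls in
               characterizes S \<eta> ls ws \<and>
               (\<forall>(ls' :: trace list) (ws' :: real list).
                   length ws' = length ls' \<and> set ls' \<subseteq> Ctr S \<and> prec_chain ls' \<and>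
                   (\<forall>w\<in>set ws'. w > 0) \<and> characterizes S \<eta> ls' ws' \<longrightarrow>
                   ls' = ls \<and> ws' = ws) \<and>
               (\<forall>e\<in>edges_dom S.
                   \<eta> e = (\<Sum>j<length ls. ws ! j * (if e \<in> tedges (ls ! j) then 1 else 0))) \<and>
               (\<forall>y\<in>S.
                   birth \<eta> y = (\<Sum>j<length ls. ws ! j * indicator (left_corners (ls ! j)) y)) \<and>
               (\<forall>y\<in>zp_dom S. zeta_plus \<eta> y = (\<Sum>j<length ls. ws ! j * zp_tr S (ls ! j) y)) \<and>
               (\<forall>y\<in>zm_dom S. zeta_minus \<eta> y = (\<Sum>j<length ls. ws ! j * zm_tr S (ls ! j) y)))) \<and>
        (\<forall>l. is_trace l \<and> in_closure S l \<longrightarrow>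
            weight \<eta> l = (\<Sum>l'\<in>Ctr S. weight \<eta> l' * (if subtrace l l' then 1 else 0))))"
proof (intro conjI allI impI)
  interpret rect a b c d by unfold_locales (use assms in auto)
  fix ls :: "trace list" and ws :: "real list"
  assume *: "length ws = length ls \<and> set ls \<subseteq> Ctr S \<and> prec_chain ls \<and> (\<forall>w\<in>set ws. w > 0)"
  then obtain \<eta> where "flow_field S \<eta>" "characterizes S \<eta> ls ws"
    using chain_realisable[of ws ls] by (auto simp: S_def)
  then show "\<exists>\<eta>. flow_field S \<eta> \<and> characterizes S \<eta> ls ws \<and>
              (\<forall>\<eta>'. flow_field S \<eta>' \<and> characterizes S \<eta>' ls ws \<longrightarrow>
                     (\<forall>e\<in>edges_dom S. \<eta>' e = \<eta> e))"
    using characterizes_determines_flow by (auto simp: S_def)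
next
  interpret rect a b c d by unfold_locales (use assms in auto)
  fix \<eta> :: "edge \<Rightarrow> real"
  assume "flow_field S \<eta>"
  then obtain h where "rect_potential a b c d h \<eta>" using potential_exists by (auto simp: S_def)
  then interpret rect_potential a b c d h \<eta> .
  let ?P = "{l\<in>Ctr S. weight \<eta> l > 0}"
  show tot: "\<forall>l\<in>?P. \<forall>l'\<in>?P.
            (tsucceq l l' \<or> tsucceq l' l) \<and>
            (tsucceq l l' \<and> tsucceq l' l \<longrightarrow> l = l') \<and>
            (\<forall>l''\<in>?P. tsucceq l l' \<and> tsucceq l' l'' \<longrightarrow> tsucceq l l'')"
    using weight_pos_comparable tsucceq_antisym tsucceq_trans unfolding S_def mem_Collect_eq by blast
  have w0: "weight \<eta> l \<ge> 0" for l by (simp add: weight_def)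
  obtain ls where ls: "set ls = ?P" "prec_chain ls"
    using prec_chain_exists[of ?P] tot unfolding S_def by blast
  have C: "set ls \<subseteq> Ctr (rect_domain a b c d)" using ls(1) S_def by auto
  have dist: "distinct ls" using prec_chain_distinct[OF C ls(2)] by simp
  have sums: "(\<Sum>j<length ls. map (weight \<eta>) ls ! j * f (ls ! j)) = (\<Sum>l\<in>Ctr S. weight \<eta> l * f l)"
    for f :: "trace \<Rightarrow> real"
  proof -
    have "(\<Sum>j<length ls. map (weight \<eta>) ls ! j * f (ls ! j)) = (\<Sum>l\<in>set ls. weight \<eta> l * f l)"
      using sum_nth_distinct[OF dist, of "\<lambda>l. weight \<eta> l * f l"] by simp
    also have "\<dots> = (\<Sum>l\<in>Ctr S. weight \<eta> l * f l)"
      using finite_Ctr w0 unfolding ls(1) S_def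
      by (intro sum.mono_neutral_left) (auto simp: order.order_iff_strict)
    finally show ?thesis .
  qed
  have char: "characterizes S \<eta> ls (map (weight \<eta>) ls)"
    using ls(1) w0 by (auto simp: characterizes_def order.order_iff_strict)
  have uniq: "ls' = ls \<and> ws' = map (weight \<eta>) ls"
    if *: "length ws' = length ls' \<and> set ls' \<subseteq> Ctr S \<and> prec_chain ls' \<and>
      (\<forall>w\<in>set ws'. w > 0) \<and> characterizes S \<eta> ls' ws'" for ls' ws'
  proof -
    have ws': "ws' = map (weight \<eta>) ls'"
      using * by (intro nth_equalityI) (auto simp: characterizes_def)
    have "set ls' = ?P"
    proof
      show "set ls' \<subseteq> ?P" using * ws' by auto
      show "?P \<subseteq> set ls'" using * by (force simp: characterizes_def)
    qed
    then have "ls' = ls" using prec_chain_unique[OF C ls(2)] * ls(1) by simp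
    then show ?thesis using ws' by simp
  qed
  show "\<exists>ls :: trace list.
            set ls = ?P \<and> prec_chain ls \<and>
            (let ws = map (weight \<eta>) ls in
               characterizes S \<eta> ls ws \<and>
               (\<forall>(ls' :: trace list) (ws' :: real list).
                   length ws' = length ls' \<and> set ls' \<subseteq> Ctr S \<and> prec_chain ls' \<and>
                   (\<forall>w\<in>set ws'. w > 0) \<and> characterizes S \<eta> ls' ws' \<longrightarrow>
                   ls' = ls \<and> ws' = ws) \<and>
               (\<forall>e\<in>edges_dom S.
                   \<eta> e = (\<Sum>j<length ls. ws ! j * (if e \<in> tedges (ls ! j) then 1 else 0))) \<and>
               (\<forall>y\<in>S.
                   birth \<eta> y = (\<Sum>j<length ls. ws ! j * indicator (left_corners (ls ! j)) y)) \<and>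
               (\<forall>y\<in>zp_dom S. zeta_plus \<eta> y = (\<Sum>j<length ls. ws ! j * zp_tr S (ls ! j) y)) \<and>
               (\<forall>y\<in>zm_dom S. zeta_minus \<eta> y = (\<Sum>j<length ls. ws ! j * zm_tr S (ls ! j) y)))"
    unfolding Let_def
  proof (intro exI[of _ ls] conjI ballI allI impI ls char)
    fix ls' ws'
    assume "length ws' = length ls' \<and> set ls' \<subseteq> Ctr S \<and> prec_chain ls' \<and>
      (\<forall>w\<in>set ws'. w > 0) \<and> characterizes S \<eta> ls' ws'"
    from uniq[OF this] show "ls' = ls" "ws' = map (weight \<eta>) ls" by auto
  next
    fix e assume "e \<in> edges_dom S"
    then show "\<eta> e = (\<Sum>j<length ls. map (weight \<eta>) ls ! j * (if e \<in> tedges (ls ! j) then 1 else 0))"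
      using sums[of "\<lambda>l. if e \<in> tedges l then 1 else 0"] eta_decomp by (simp add: S_def)
  next
    fix y assume "y \<in> S"
    then show "birth \<eta> y = (\<Sum>j<length ls. map (weight \<eta>) ls ! j * indicator (left_corners (ls ! j)) y)"
      using sums[of "\<lambda>l. indicator (left_corners l) y"] birth_decomp by (simp add: S_def)
  next
    fix y assume "y \<in> zp_dom S"
    then show "zeta_plus \<eta> y = (\<Sum>j<length ls. map (weight \<eta>) ls ! j * zp_tr S (ls ! j) y)"
      using sums[of "\<lambda>l. zp_tr S l y"] zeta_plus_decomp by (simp add: S_def)
  next
    fix y assume "y \<in> zm_dom S"
    then show "zeta_minus \<eta> y = (\<Sum>j<length ls. map (weight \<eta>) ls ! j * zm_tr S (ls ! j) y)"
      using sums[of "\<lambda>l. zm_tr S l y"] zeta_minus_decomp by (simp add: S_def)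
  qed
  fix l assume "is_trace l \<and> in_closure S l"
  then show "weight \<eta> l = (\<Sum>l'\<in>Ctr S. weight \<eta> l' * (if subtrace l l' then 1 else 0))"
    using weight_decomp by (simp add: S_def)
qed

end
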